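(* For integers $k,m\ge 1$, $$P_{x_{k,2,m},w_{k,2,m}}=1+q.$$
   Context: $P_{x,w}=P_{x,w}(q)$ denotes the Kazhdan–Lusztig polynomial indexed by $x,w$ in the symmetric group $\mathfrak{S}_n$ (normalized as usual: $P_{x,w}=0$ unless $x\le w$ in Bruhat order, $P_{w,w}=1$, and $\deg P_{x,w}\le\frac12(l(w)-l(x)-1)$ for $x<w$). In $\mathfrak{S}_{k+2+m}$, in one-line notation, $$x_{k,2,m}=[k,\ldots,1,\;k+2,k+1,\;k+2+m,\ldots,k+3],$$ $$w_{k,2,m}=[k+2,\;k,\ldots,2,\;k+2+m,\;1,\;k+m+1,\ldots,k+3,\;k+1],$$ where each range "$a,\ldots,b$" denotes the decreasing run of consecutive integers from $a$ down to $b$, which is empty if $a<b$. *)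

theory Defs
  imports
    "HOL-Combinatorics.Permutations"
    "HOL-Computational_Algebra.Polynomial"
    "HOL-Library.Poly_Mapping"
    "HOL-Algebra.Ring"
begin

unbundle no m_inv_syntax

section \<open>Symmetric groups: length, Bruhat order, one-line notation\<close>

text \<open>The elements of the symmetric group on n letters are the functions w with
  \<^term>\<open>w permutes {1..n}\<close>; the group operation is composition of functions.\<close>

type_synonym perm = "nat \<Rightarrow> nat"

definition sym_grp :: "nat \<Rightarrow> perm set" where
  "sym_grp n = {w. w permutes {1..n}}"

definition perm_len :: "perm \<Rightarrow> nat" where
  "perm_len w = card {(i, j). i < j \<and> w j < w i}"

definition bruhat_step :: "nat \<Rightarrow> perm \<Rightarrow> perm \<Rightarrow> bool" where
  "bruhat_step n u v \<longleftrightarrow>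
     (\<exists>i j. 1 \<le> i \<and> i < j \<and> j \<le> n \<and> v = u \<circ> transpose i j \<and> perm_len u < perm_len v)"

definition bruhat_le :: "nat \<Rightarrow> perm \<Rightarrow> perm \<Rightarrow> bool" where
  "bruhat_le n u v \<longleftrightarrow> u \<in> sym_grp n \<and> v \<in> sym_grp n \<and> (bruhat_step n)\<^sup>*\<^sup>* u v"

definition one_line :: "nat list \<Rightarrow> perm" where
  "one_line xs i = (if 1 \<le> i \<and> i \<le> length xs then xs ! (i - 1) else i)"

definition down :: "nat \<Rightarrow> nat \<Rightarrow> nat list" where
  "down a b = rev [b..<Suc a]"

definition simple_refl :: "nat \<Rightarrow> perm" where
  "simple_refl i = transpose i (Suc i)"

definition reduced_word :: "nat \<Rightarrow> nat list \<Rightarrow> perm \<Rightarrow> bool" where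
  "reduced_word n is w \<longleftrightarrow>
     set is \<subseteq> {1..<n} \<and> length is = perm_len w \<and> foldr (\<lambda>i u. simple_refl i \<circ> u) is id = w"

section \<open>The Hecke algebra of the symmetric group\<close>

text \<open>The ground ring is the ring of integral Laurent polynomials in v, where v is the square root
  of q, realised as the group ring of the additive group of integers.\<close>

type_synonym laurent = "int \<Rightarrow>\<^sub>0 int"

definition v_pow :: "int \<Rightarrow> laurent" where
  "v_pow k = Poly_Mapping.single k 1"

definition q_var :: laurent where
  "q_var = v_pow 2"

definition laurent_bar :: "laurent \<Rightarrow> laurent" where
  "laurent_bar = Poly_Mapping.map_key uminus"

text \<open>An element of the Hecke algebra is the function taking w to its coefficient at the standard
  basis element indexed by w.\<close>

type_synonym hecke_elt = "perm \<Rightarrow> laurent"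

definition T_elt :: "perm \<Rightarrow> hecke_elt" where
  "T_elt w = (\<lambda>u. if u = w then 1 else 0)"

text \<open>With s the i-th simple reflection, the product of the basis elements at s and w is the basis
  element at sw if sw is longer than w; otherwise it is (q - 1) times the one at w plus q times
  the one at sw.\<close>

definition gen_mult_basis :: "nat \<Rightarrow> perm \<Rightarrow> hecke_elt" where
  "gen_mult_basis i w =
     (let sw = simple_refl i \<circ> w in
      if perm_len w < perm_len sw then T_elt sw
      else (\<lambda>u. (q_var - 1) * T_elt w u + q_var * T_elt sw u))"

definition gen_mult :: "nat \<Rightarrow> nat \<Rightarrow> hecke_elt \<Rightarrow> hecke_elt" where
  "gen_mult n i h = (\<lambda>u. \<Sum>w\<in>sym_grp n. h w * gen_mult_basis i w u)"

text \<open>Left multiplication by the basis element at w is the composite of the left multiplications by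
  the generators in a reduced word of w. By the braid relations the choice of the word is
  immaterial.\<close>

definition T_mult :: "nat \<Rightarrow> perm \<Rightarrow> hecke_elt \<Rightarrow> hecke_elt" where
  "T_mult n w h = foldr (gen_mult n) (SOME is. reduced_word n is w) h"

definition hecke :: "nat \<Rightarrow> hecke_elt ring" where
  "hecke n =
     \<lparr> carrier = {h. \<forall>w. w \<notin> sym_grp n \<longrightarrow> h w = 0},
       mult = (\<lambda>a b u. \<Sum>w\<in>sym_grp n. a w * T_mult n w b u),
       one = T_elt id,
       zero = (\<lambda>_. 0),
       add = (\<lambda>a b u. a u + b u) \<rparr>"

text \<open>The semilinear involution that sends the basis element at w to the inverse of the basis
  element at the inverse of w.\<close>

definition hecke_bar :: "nat \<Rightarrow> hecke_elt \<Rightarrow> hecke_elt" where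
  "hecke_bar n h =
     (\<lambda>u. \<Sum>w\<in>sym_grp n. laurent_bar (h w) * m_inv (hecke n) (T_elt (inv w)) u)"

section \<open>Kazhdan--Lusztig polynomials\<close>

definition at_q :: "int poly \<Rightarrow> laurent" where
  "at_q p = poly (map_poly of_int p) q_var"

definition kl_elt :: "perm \<Rightarrow> (perm \<Rightarrow> int poly) \<Rightarrow> hecke_elt" where
  "kl_elt w P = (\<lambda>x. v_pow (- int (perm_len w)) * at_q (P x))"

text \<open>The family of all polynomials with second index w. The degree bound is written without
  truncated subtraction.\<close>

definition is_kl_family :: "nat \<Rightarrow> perm \<Rightarrow> (perm \<Rightarrow> int poly) \<Rightarrow> bool" where
  "is_kl_family n w P \<longleftrightarrow>
     (\<forall>x. \<not> bruhat_le n x w \<longrightarrow> P x = 0) \<and>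
     P w = 1 \<and>
     (\<forall>x. bruhat_le n x w \<and> x \<noteq> w \<longrightarrow> 2 * degree (P x) + perm_len x + 1 \<le> perm_len w) \<and>
     hecke_bar n (kl_elt w P) = kl_elt w P"

definition kl_poly :: "nat \<Rightarrow> perm \<Rightarrow> perm \<Rightarrow> int poly" where
  "kl_poly n x w = (THE P. is_kl_family n w P) x"

section \<open>The permutations of the statement\<close>

definition x_perm :: "nat \<Rightarrow> nat \<Rightarrow> perm" where
  "x_perm k m = one_line (down k 1 @ [k + 2, k + 1] @ down (k + 2 + m) (k + 3))"

definition w_perm :: "nat \<Rightarrow> nat \<Rightarrow> perm" where
  "w_perm k m =
     one_line ([k + 2] @ down k 2 @ [k + 2 + m, 1] @ down (k + m + 1) (k + 3) @ [k + 1])"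

end

theory Submission
  imports Defs
begin

text \<open>
  Put \<open>c = k + 1\<close> and let s be the c-th simple reflection. Let K be the stabiliser of \<open>{1..c}\<close>, a
  maximal parabolic subgroup of the symmetric group, with longest element r. The permutation w of
  the statement is \<open>s r s\<close>, of length \<open>l(r) + 2\<close>. The whole Kazhdan--Lusztig basis element at w
  is the product of those at s, r and s:
  \<open>v\<close> to the power \<open>- l(w)\<close> times \<open>(1 + T\<^sub>s) E (1 + T\<^sub>s)\<close>, where E is the sum of the \<open>T\<^sub>u\<close> with u in K.

  Each factor is invariant under the bar involution up to a power of q: for \<open>1 + T\<^sub>s\<close> this is the
  quadratic relation, and E is characterised up to scalars by \<open>T\<^sub>t E = q E\<close> for the simple
  reflections t in K (\<open>hecke_bar_parab_sum\<close>). So the product is invariant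
  (\<open>hecke_bar_kl_coeff\<close>). Its coefficients can be read off directly. The terms u, us, su, sus are
  different for all u in K that do not commute with s and have coefficient 1. If u commutes with
  s, which means that u fixes c and \<open>c + 1\<close>, the four terms collapse to u and us, both with
  coefficient \<open>1 + q\<close> (\<open>left_product_coeff\<close>). The permutation x of the statement is of the second kind.

  It remains to see that these coefficients satisfy the conditions that single out the
  Kazhdan--Lusztig polynomials. All permutations that occur are below w in Bruhat order, because
  each of them other than w can be lengthened by a transposition without leaving the support
  (\<open>product_support_step_up\<close>). For the degree bound, a permutation with coefficient \<open>1 + q\<close> must be
  at least three shorter than w; this holds because u can be lengthened in K by the generators
  with indices \<open>c - 1\<close> and \<open>c + 1\<close>, which exist because k and m are positive
  (\<open>perm_len_double_support\<close>).

  Two general facts about the Hecke algebra underlie this. Left multiplications commute with right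
  multiplications, so they are determined by their value at the identity (\<open>left_op_eqI\<close>). This
  identifies the inverses that occur in the definition of the bar involution as products of
  inverse generators along any reduced word (\<open>T_dual_eq_lmul_inv_word\<close>), and shows that the bar
  involution inverts generators on either side. And the family of polynomials is unique, because
  the bar involution is triangular with respect to length (\<open>kl_family_unique\<close>).
\<close>

section \<open>Permutations and their lengths\<close>

lemma sym_grp_id [simp]: "id \<in> sym_grp n"
  by (simp add: sym_grp_def permutes_id)

lemma sym_grp_comp: "u \<in> sym_grp n \<Longrightarrow> w \<in> sym_grp n \<Longrightarrow> u \<circ> w \<in> sym_grp n"
  by (simp add: sym_grp_def permutes_compose)

lemma sym_grp_inv: "w \<in> sym_grp n \<Longrightarrow> inv w \<in> sym_grp n"
  by (simp add: sym_grp_def permutes_inv)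

lemma sym_grp_bij: "w \<in> sym_grp n \<Longrightarrow> bij w"
  by (auto simp: sym_grp_def permutes_bij)

lemma finite_sym_grp [simp]: "finite (sym_grp n)"
  by (simp add: sym_grp_def finite_permutations)

lemma sym_grp_range: "w \<in> sym_grp n \<Longrightarrow> 1 \<le> w i \<and> w i \<le> n \<longleftrightarrow> 1 \<le> i \<and> i \<le> n"
  unfolding sym_grp_def using permutes_in_image[of w "{1..n}" i] by simp

lemma sym_grp_outside: "w \<in> sym_grp n \<Longrightarrow> \<not> (1 \<le> i \<and> i \<le> n) \<Longrightarrow> w i = i"
  by (auto simp: sym_grp_def permutes_def)

lemma sym_grp_inv_apply:
  "w \<in> sym_grp n \<Longrightarrow> inv w (w i) = i" "w \<in> sym_grp n \<Longrightarrow> w (inv w i) = i"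
  by (auto simp: sym_grp_def permutes_inverses)

lemma sym_grp_eq_iff: "w \<in> sym_grp n \<Longrightarrow> w i = w j \<longleftrightarrow> i = j"
  using sym_grp_inv_apply(1) by metis

lemma simple_refl_apply:
  "simple_refl i j = (if j = i then Suc i else if j = Suc i then i else j)"
  by (simp add: simple_refl_def transpose_def)

lemma simple_refl_sym_grp: "i \<in> {1..<n} \<Longrightarrow> simple_refl i \<in> sym_grp n"
  by (auto simp: sym_grp_def simple_refl_def intro!: permutes_swap_id)

lemma simple_refl_comp_cancel [simp]:
  "simple_refl i \<circ> (simple_refl i \<circ> w) = w" "(w \<circ> simple_refl i) \<circ> simple_refl i = w"
  "simple_refl i (simple_refl i j) = j"
  by (auto simp: fun_eq_iff simple_refl_apply)

lemma inv_simple_refl [simp]: "inv (simple_refl i) = simple_refl i"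
  by (simp add: simple_refl_def)

lemma bij_simple_refl [simp]: "bij (simple_refl i)"
  by (simp add: simple_refl_def)

lemma inv_simple_refl_comp:
  "bij w \<Longrightarrow> inv (simple_refl i \<circ> w) = inv w \<circ> simple_refl i"
  "bij w \<Longrightarrow> inv (w \<circ> simple_refl i) = simple_refl i \<circ> inv w"
  by (simp_all add: o_inv_distrib)

lemma left_mult_sym_grp_iff:
  assumes "i \<in> {1..<n}"
  shows "simple_refl i \<circ> w \<in> sym_grp n \<longleftrightarrow> w \<in> sym_grp n"
  by (metis assms simple_refl_comp_cancel(1) simple_refl_sym_grp sym_grp_comp)

lemma right_mult_sym_grp_iff:
  assumes "i \<in> {1..<n}"
  shows "w \<circ> simple_refl i \<in> sym_grp n \<longleftrightarrow> w \<in> sym_grp n"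
  by (metis assms simple_refl_comp_cancel(2) simple_refl_sym_grp sym_grp_comp)

lemma finite_inversions:
  assumes "w \<in> sym_grp n"
  shows "finite {(i, j). i < j \<and> w j < w i}"
proof (rule finite_subset)
  show "{(i, j). i < j \<and> w j < w i} \<subseteq> {1..n} \<times> {1..n}"
  proof clarify
    fix i j assume ij: "i < j" "w j < w i"
    have *: "1 \<le> i \<and> i \<le> n" "1 \<le> j \<and> j \<le> n"
      using ij sym_grp_range[OF assms, of i] sym_grp_range[OF assms, of j]
        sym_grp_outside[OF assms, of i] sym_grp_outside[OF assms, of j]
      by linarith+
    then show "i \<in> {1..n} \<and> j \<in> {1..n}" by simp
  qed
qed simp

text \<open>Exchanging the values i and i + 1 alters the relative order of that pair only, so the
  inversion set gains one element.\<close>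

lemma perm_len_left_ascent:
  assumes w: "w \<in> sym_grp n" and asc: "inv w i < inv w (Suc i)"
  shows "perm_len (simple_refl i \<circ> w) = Suc (perm_len w)"
proof -
  define p p' where "p = inv w i" and "p' = inv w (Suc i)"
  have wp: "w p = i" "w p' = Suc i" by (simp_all add: p_def p'_def sym_grp_inv_apply(2)[OF w])
  have at_p: "a = p" if "w a = i" for a using that sym_grp_eq_iff[OF w] wp by metis
  have at_p': "a = p'" if "w a = Suc i" for a using that sym_grp_eq_iff[OF w] wp by metis
  have "p < p'" using asc by (simp add: p_def p'_def)
  have "{(a, b). a < b \<and> (simple_refl i \<circ> w) b < (simple_refl i \<circ> w) a}
      = insert (p, p') {(a, b). a < b \<and> w b < w a}" (is "?L = insert _ ?R")
  proof -
    have "(a, b) \<in> ?L \<longleftrightarrow> (a, b) \<in> insert (p, p') ?R" for a b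
    proof (cases "a < b")
      case True
      then have "w a \<noteq> w b" using sym_grp_eq_iff[OF w] by simp
      moreover have "\<not> (w b = i \<and> w a = Suc i)" using at_p at_p' True \<open>p < p'\<close> by fastforce
      moreover have "w b = Suc i \<and> w a = i \<longleftrightarrow> a = p \<and> b = p'" using at_p at_p' wp by blast
      ultimately show ?thesis using True by (auto simp: simple_refl_apply)
    qed (use \<open>p < p'\<close> in auto)
    then show ?thesis by (auto simp only:)
  qed
  moreover have "(p, p') \<notin> ?R" using wp by simp
  ultimately show ?thesis
    unfolding perm_len_def using finite_inversions[OF w] by simp
qed

lemma perm_len_inv:
  assumes w: "w \<in> sym_grp n"
  shows "perm_len (inv w) = perm_len w"
proof -
  have "bij_betw (\<lambda>(a, b). (w b, w a)) {(a, b). a < b \<and> w b < w a}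
          {(a, b). a < b \<and> inv w b < inv w a}"
    by (rule bij_betw_byWitness[where f' = "\<lambda>(a, b). (inv w b, inv w a)"]) (auto simp: sym_grp_inv_apply[OF w])
  then show ?thesis unfolding perm_len_def by (simp add: bij_betw_same_card)
qed

lemma perm_len_right_ascent:
  assumes w: "w \<in> sym_grp n" and i: "i \<in> {1..<n}" and asc: "w i < w (Suc i)"
  shows "perm_len (w \<circ> simple_refl i) = Suc (perm_len w)"
proof -
  have "perm_len (w \<circ> simple_refl i) = perm_len (simple_refl i \<circ> inv w)"
    using perm_len_inv[of "w \<circ> simple_refl i" n] right_mult_sym_grp_iff[OF i] w
    by (simp add: inv_simple_refl_comp(2)[OF sym_grp_bij[OF w]])
  also have "\<dots> = Suc (perm_len (inv w))"
    using perm_len_left_ascent[OF sym_grp_inv[OF w], of i] asc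
    by (simp add: inv_inv_eq[OF sym_grp_bij[OF w]])
  finally show ?thesis using perm_len_inv[OF w] by simp
qed

lemma left_ascent_flip:
  assumes "w \<in> sym_grp n"
  shows "inv (simple_refl i \<circ> w) i < inv (simple_refl i \<circ> w) (Suc i) \<longleftrightarrow> \<not> inv w i < inv w (Suc i)"
proof -
  have "inv w i \<noteq> inv w (Suc i)" 
    using sym_grp_eq_iff[OF sym_grp_inv[OF assms], of i "Suc i"] by simp
  then show ?thesis
    by (simp add: inv_simple_refl_comp(1)[OF sym_grp_bij[OF assms]] simple_refl_apply) linarith
qed

lemma right_ascent_flip:
  assumes "w \<in> sym_grp n"
  shows "(w \<circ> simple_refl i) i < (w \<circ> simple_refl i) (Suc i) \<longleftrightarrow> \<not> w i < w (Suc i)"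
  using sym_grp_eq_iff[OF assms, of i "Suc i"] by (auto simp: simple_refl_apply)

lemma perm_len_left_descent:
  assumes "w \<in> sym_grp n" "i \<in> {1..<n}" "\<not> inv w i < inv w (Suc i)"
  shows "perm_len w = Suc (perm_len (simple_refl i \<circ> w))"
  using perm_len_left_ascent[of "simple_refl i \<circ> w" n i] assms left_ascent_flip[OF assms(1)]
  by (simp add: left_mult_sym_grp_iff)

lemma perm_len_id [simp]: "perm_len id = 0"
proof -
  have "{(i, j). i < j \<and> id j < (id i :: nat)} = {}" by auto
  then show ?thesis unfolding perm_len_def by (simp only: card.empty)
qed

text \<open>Without descents both w and its inverse are strictly increasing, hence both are at least the
  identity.\<close>

lemma no_descent_imp_id:
  assumes w: "w \<in> sym_grp n" and asc: "\<And>i. i \<in> {1..<n} \<Longrightarrow> w i < w (Suc i)"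
  shows "w = id"
proof -
  have "w i < w (Suc i)" for i
  proof -
    have "w i < w (Suc i)" if "i \<notin> {1..<n}"
    proof (cases "i = 0")
      case True
      then have "w i = 0" using sym_grp_outside[OF w, of 0] by simp
      moreover have "w (Suc i) \<noteq> w i" using sym_grp_eq_iff[OF w] by simp
      ultimately show ?thesis by linarith
    next
      case False
      then have "w (Suc i) = Suc i" using that sym_grp_outside[OF w, of "Suc i"] by simp
      moreover have "w i \<le> i"
        using that False sym_grp_outside[OF w, of i] sym_grp_range[OF w, of i] by (cases "i = n") auto
      ultimately show ?thesis by linarith
    qed
    then show ?thesis using asc by blast
  qed
  then have mono: "strict_mono w" by (simp add: strict_mono_Suc_iff)
  have "strict_mono (inv w)"
    unfolding strict_mono_def using strict_mono_less[OF mono] sym_grp_inv_apply(2)[OF w] by metis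
  then have "inv w i \<ge> i" for i by (rule strict_mono_imp_increasing)
  moreover have "w i \<ge> i" for i using mono by (rule strict_mono_imp_increasing)
  ultimately have "w i = i" for i 
    using sym_grp_inv_apply(2)[OF w, of i] by (metis order_antisym)
  then show ?thesis by (simp add: fun_eq_iff)
qed

section \<open>Maximal parabolic subgroups and reduced words\<close>

text \<open>The stabiliser of \<open>{1..c}\<close> is the parabolic subgroup generated by all simple reflections
  except the c-th. For \<open>c = n\<close> it is the whole symmetric group.\<close>

definition parab :: "nat \<Rightarrow> nat \<Rightarrow> perm set" where
  "parab n c = {u \<in> sym_grp n. u ` {1..c} = {1..c}}"

lemma parab_sym_grp: "u \<in> parab n c \<Longrightarrow> u \<in> sym_grp n"
  by (simp add: parab_def)

lemma parab_full [simp]: "parab n n = sym_grp n"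
proof -
  have "u ` {1..n} = {1..n}" if "u \<in> sym_grp n" for u
    using that permutes_image unfolding sym_grp_def by blast
  then show ?thesis unfolding parab_def by blast
qed

lemma id_parab [simp]: "id \<in> parab n c"
  by (simp add: parab_def)

lemma parab_comp: "u \<in> parab n c \<Longrightarrow> w \<in> parab n c \<Longrightarrow> u \<circ> w \<in> parab n c"
  unfolding parab_def using image_comp[of u w "{1..c}"] by (simp add: sym_grp_comp)

lemma simple_refl_parab: "i \<in> {1..<n} \<Longrightarrow> i \<noteq> c \<Longrightarrow> simple_refl i \<in> parab n c"
proof -
  assume i: "i \<in> {1..<n}" "i \<noteq> c"
  have "simple_refl i permutes {1..c}" if "i < c"
    unfolding simple_refl_def using i that by (intro permutes_swap_id) auto
  moreover have "simple_refl i ` {1..c} = {1..c}" if "c < i"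
    using that by (force simp: simple_refl_apply image_iff)
  ultimately show ?thesis
    using i simple_refl_sym_grp[of i n] permutes_image[of "simple_refl i" "{1..c}"]
    unfolding parab_def by (cases "i < c") auto
qed

lemma parab_block:
  assumes "u \<in> parab n c"
  shows "1 \<le> u i \<and> u i \<le> c \<longleftrightarrow> 1 \<le> i \<and> i \<le> c"
proof -
  have u: "u \<in> sym_grp n" "u ` {1..c} = {1..c}" using assms by (auto simp: parab_def)
  have "u i \<in> {1..c} \<longleftrightarrow> i \<in> {1..c}"
    using inj_image_mem_iff[OF bij_is_inj[OF sym_grp_bij[OF u(1)]], of i "{1..c}"] u(2) by simp
  then show ?thesis by simp
qed

lemma parab_inv:
  assumes "u \<in> parab n c"
  shows "inv u \<in> parab n c"
proof -
  have u: "u \<in> sym_grp n" using assms by (rule parab_sym_grp)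
  have "inv u ` {1..c} = {1..c}"
    using assms image_inv_f_f[OF bij_is_inj[OF sym_grp_bij[OF u]], of "{1..c}"]
    by (simp add: parab_def)
  then show ?thesis using u by (simp add: parab_def sym_grp_inv)
qed

lemma parab_left_mult_iff:
  assumes "i \<in> {1..<n}" "i \<noteq> c"
  shows "simple_refl i \<circ> w \<in> parab n c \<longleftrightarrow> w \<in> parab n c"
  by (metis assms parab_comp simple_refl_comp_cancel(1) simple_refl_parab)

lemma parab_right_mult_iff:
  assumes "i \<in> {1..<n}" "i \<noteq> c"
  shows "w \<circ> simple_refl i \<in> parab n c \<longleftrightarrow> w \<in> parab n c"
  by (metis assms parab_comp simple_refl_comp_cancel(2) simple_refl_parab)

lemma parab_ascent:
  assumes "u \<in> parab n c" "1 \<le> c" "c < n"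
  shows "u c \<le> c" "Suc c \<le> u (Suc c)" "u c < u (Suc c)"
proof -
  show "u c \<le> c" using parab_block[OF assms(1), of c] assms by simp
  moreover show "Suc c \<le> u (Suc c)"
    using parab_block[OF assms(1), of "Suc c"] sym_grp_range[OF parab_sym_grp[OF assms(1)], of "Suc c"]
      assms by auto
  ultimately show "u c < u (Suc c)" by linarith
qed

text \<open>Multiplying by the generator at a left descent shortens a permutation. One that stabilises
  \<open>{1..c}\<close> has no left descent at c, so the letter c is never chosen.\<close>

lemma reduced_word_exists:
  assumes "w \<in> parab n c" "1 \<le> c" "c \<le> n"
  shows "\<exists>ws. reduced_word n ws w \<and> c \<notin> set ws"
  using assms(1)
proof (induction "perm_len w" arbitrary: w rule: less_induct)
  case less
  then have w: "w \<in> sym_grp n" by (simp add: parab_sym_grp)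
  show ?case
  proof (cases "w = id")
    case True
    then show ?thesis by (intro exI[of _ "[]"]) (simp add: reduced_word_def)
  next
    case False
    then have "inv w \<noteq> id" using inv_inv_eq[OF sym_grp_bij[OF w]] inv_id by metis
    then obtain i where i: "i \<in> {1..<n}" "\<not> inv w i < inv w (Suc i)"
      using no_descent_imp_id[OF sym_grp_inv[OF w]] by blast
    have ic: "i \<noteq> c" using parab_ascent(3)[OF parab_inv[OF less.prems] assms(2)] i by auto
    have len: "perm_len w = Suc (perm_len (simple_refl i \<circ> w))"
      using perm_len_left_descent[OF w i] .
    obtain ws where ws: "reduced_word n ws (simple_refl i \<circ> w)" "c \<notin> set ws"
      using less.hyps[of "simple_refl i \<circ> w"] less.prems len i ic parab_left_mult_iff by auto
    have "reduced_word n (i # ws) w" using ws(1) i len by (auto simp: reduced_word_def)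
    then show ?thesis using ws(2) ic by (intro exI[of _ "i # ws"]) simp
  qed
qed

lemma reduced_word_exists_sym_grp: "w \<in> sym_grp n \<Longrightarrow> \<exists>ws. reduced_word n ws w"
proof (cases "n = 0")
  case True
  assume "w \<in> sym_grp n"
  then have "w = id" using True no_descent_imp_id by auto
  then show ?thesis by (intro exI[of _ "[]"]) (simp add: reduced_word_def)
qed (use reduced_word_exists[of w n n] in auto)

section \<open>Laurent polynomials\<close>

definition q_inv :: laurent where
  "q_inv = v_pow (- 2)"

lemma v_pow_0 [simp]: "v_pow 0 = 1"
  by (simp add: v_pow_def)

lemma v_pow_mult: "v_pow a * v_pow b = v_pow (a + b)"
  by (simp add: v_pow_def mult_single)

lemma q_inv_cancel [simp]: "q_inv * q_var = 1" "q_var * q_inv = 1"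
  "q_inv * (q_var * a) = a" "q_var * (q_inv * a) = a"
  by (simp_all add: q_inv_def q_var_def v_pow_mult flip: mult.assoc)

lemma lookup_v_pow_mult: "Poly_Mapping.lookup (v_pow k * a) e = Poly_Mapping.lookup a (e - k)"
proof (induction a rule: update_induct)
  case const
  then show ?case by simp
next
  case (update f a b)
  have split: "Poly_Mapping.update a b f = f + Poly_Mapping.single a b"
    using update by (intro poly_mapping_eqI)
      (auto simp: lookup_update lookup_add lookup_single in_keys_iff when_def)
  show ?case
    using update.IH unfolding split distrib_left lookup_add
    by (simp add: v_pow_def mult_single lookup_single when_def eq_diff_eq add.commute)
qed

lemma lookup_laurent_bar: "Poly_Mapping.lookup (laurent_bar a) e = Poly_Mapping.lookup a (- e)"
  unfolding laurent_bar_def by (subst map_key.rep_eq) (simp_all add: inj_uminus)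

lemma laurent_bar_add: "laurent_bar (a + b) = laurent_bar a + laurent_bar b"
  by (rule poly_mapping_eqI) (simp add: lookup_laurent_bar lookup_add)

lemma laurent_bar_diff: "laurent_bar (a - b) = laurent_bar a - laurent_bar b"
  by (rule poly_mapping_eqI) (simp add: lookup_laurent_bar lookup_minus)

lemma laurent_bar_0 [simp]: "laurent_bar 0 = 0"
  by (rule poly_mapping_eqI) (simp add: lookup_laurent_bar)

lemma laurent_bar_1 [simp]: "laurent_bar 1 = 1"
  by (rule poly_mapping_eqI) (simp add: lookup_laurent_bar lookup_one when_def)

lemma laurent_bar_v_pow_mult: "laurent_bar (v_pow k * a) = v_pow (- k) * laurent_bar a"
  by (rule poly_mapping_eqI) (simp add: lookup_laurent_bar lookup_v_pow_mult)

lemma laurent_bar_q_mult: "laurent_bar (q_var * a) = q_inv * laurent_bar a"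
  by (simp add: q_var_def q_inv_def laurent_bar_v_pow_mult)

section \<open>Multiplication by a generator on the left and on the right\<close>

abbreviation left_ascent :: "nat \<Rightarrow> perm \<Rightarrow> bool" where
  "left_ascent i u \<equiv> inv u i < inv u (Suc i)"

abbreviation right_ascent :: "nat \<Rightarrow> perm \<Rightarrow> bool" where
  "right_ascent i u \<equiv> u i < u (Suc i)"

text \<open>The products \<open>T\<^sub>s h\<close> and \<open>h T\<^sub>s\<close>, written through the coefficients of h: the value at u
  involves only the values of h at u and at its neighbour. In this form identities between the
  operators are checked point by point.\<close>

definition lmul :: "nat \<Rightarrow> hecke_elt \<Rightarrow> hecke_elt" where
  "lmul i h = (\<lambda>u. if left_ascent i u then q_var * h (simple_refl i \<circ> u)
     else h (simple_refl i \<circ> u) + (q_var - 1) * h u)"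

definition rmul :: "nat \<Rightarrow> hecke_elt \<Rightarrow> hecke_elt" where
  "rmul i h = (\<lambda>u. if right_ascent i u then q_var * h (u \<circ> simple_refl i)
     else h (u \<circ> simple_refl i) + (q_var - 1) * h u)"

text \<open>The products with \<open>T\<^sub>s\<inverse> = q\<inverse> T\<^sub>s + q\<inverse> - 1\<close>.\<close>

definition lmul_inv :: "nat \<Rightarrow> hecke_elt \<Rightarrow> hecke_elt" where
  "lmul_inv i h = (\<lambda>u. if left_ascent i u then h (simple_refl i \<circ> u) + (q_inv - 1) * h u
     else q_inv * h (simple_refl i \<circ> u))"

definition rmul_inv :: "nat \<Rightarrow> hecke_elt \<Rightarrow> hecke_elt" where
  "rmul_inv i h = (\<lambda>u. if right_ascent i u then h (u \<circ> simple_refl i) + (q_inv - 1) * h u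
     else q_inv * h (u \<circ> simple_refl i))"

abbreviation hecke_space :: "nat \<Rightarrow> hecke_elt set" where
  "hecke_space n \<equiv> carrier (hecke n)"

lemma hecke_space_iff: "h \<in> hecke_space n \<longleftrightarrow> (\<forall>w. w \<notin> sym_grp n \<longrightarrow> h w = 0)"
  by (simp add: hecke_def)

lemma hecke_space_outside: "h \<in> hecke_space n \<Longrightarrow> w \<notin> sym_grp n \<Longrightarrow> h w = 0"
  by (simp add: hecke_def)

lemma hecke_space_eqI:
  assumes "g \<in> hecke_space n" "h \<in> hecke_space n" "\<And>u. u \<in> sym_grp n \<Longrightarrow> g u = h u"
  shows "g = h"
  using assms by (auto simp: hecke_space_iff fun_eq_iff) metis

lemma T_elt_in_hecke_space: "w \<in> sym_grp n \<Longrightarrow> T_elt w \<in> hecke_space n"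
  by (auto simp: hecke_space_iff T_elt_def)

lemma generator_ops_in_hecke_space:
  assumes "i \<in> {1..<n}" "h \<in> hecke_space n"
  shows "lmul i h \<in> hecke_space n" "rmul i h \<in> hecke_space n"
    "lmul_inv i h \<in> hecke_space n" "rmul_inv i h \<in> hecke_space n"
  using assms(2) left_mult_sym_grp_iff[OF assms(1)] right_mult_sym_grp_iff[OF assms(1)]
  by (simp_all add: hecke_space_iff lmul_def rmul_def lmul_inv_def rmul_inv_def)

lemma generator_inverses:
  assumes "i \<in> {1..<n}" "h \<in> hecke_space n"
  shows "lmul i (lmul_inv i h) = h" "lmul_inv i (lmul i h) = h"
    "rmul i (rmul_inv i h) = h" "rmul_inv i (rmul i h) = h"
proof -
  have l: "lmul i (lmul_inv i h) u = h u" "lmul_inv i (lmul i h) u = h u" if "u \<in> sym_grp n" for u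
    using left_ascent_flip[OF that, of i]
    by (auto simp: lmul_def lmul_inv_def algebra_simps)
  have r: "rmul i (rmul_inv i h) u = h u" "rmul_inv i (rmul i h) u = h u" if "u \<in> sym_grp n" for u
    using right_ascent_flip[OF that, of i]
    by (auto simp: rmul_def rmul_inv_def algebra_simps simp del: o_apply)
  note closed = generator_ops_in_hecke_space[OF assms(1)]
  show "lmul i (lmul_inv i h) = h" "lmul_inv i (lmul i h) = h"
    "rmul i (rmul_inv i h) = h" "rmul_inv i (rmul i h) = h"
    by (rule hecke_space_eqI[of _ n]; use assms closed l r in simp)+
qed

lemma simple_refl_less_iff:
  assumes "x \<noteq> y" "{x, y} \<noteq> {j, Suc j}"
  shows "simple_refl j x < simple_refl j y \<longleftrightarrow> x < y"
  using assms by (auto simp: simple_refl_apply insert_commute)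

text \<open>Multiplication by one generator on the left and by another one on the right interfere only if
  they have the same effect on u, that is, if u maps \<open>{j, j + 1}\<close> onto \<open>{i, i + 1}\<close>.\<close>

lemma ascent_after_opposite_mult:
  assumes u: "u \<in> sym_grp n"
  shows "simple_refl i \<circ> u = u \<circ> simple_refl j \<Longrightarrow> left_ascent i u \<longleftrightarrow> right_ascent j u"
    and "simple_refl i \<circ> u \<noteq> u \<circ> simple_refl j \<Longrightarrow>
      left_ascent i (u \<circ> simple_refl j) \<longleftrightarrow> left_ascent i u"
    and "simple_refl i \<circ> u \<noteq> u \<circ> simple_refl j \<Longrightarrow>
      right_ascent j (simple_refl i \<circ> u) \<longleftrightarrow> right_ascent j u"
proof -
  note inj = sym_grp_eq_iff[OF u] and inv = sym_grp_inv_apply[OF u]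
  have commute: "simple_refl i \<circ> u = u \<circ> simple_refl j" if "{u j, u (Suc j)} = {i, Suc i}"
  proof
    fix x
    have "u j = i \<and> u (Suc j) = Suc i \<or> u j = Suc i \<and> u (Suc j) = i"
      using that by (simp only: doubleton_eq_iff)
    moreover have "x \<noteq> j \<Longrightarrow> u x \<noteq> u j" "x \<noteq> Suc j \<Longrightarrow> u x \<noteq> u (Suc j)"
      using inj by blast+
    ultimately show "(simple_refl i \<circ> u) x = (u \<circ> simple_refl j) x"
      by (cases "x = j"; cases "x = Suc j") (simp_all add: simple_refl_apply, metis+)
  qed
  show "left_ascent i u \<longleftrightarrow> right_ascent j u" if eq: "simple_refl i \<circ> u = u \<circ> simple_refl j"
  proof -
    have eq_at: "simple_refl i (u j) = u (Suc j)"
      using fun_cong[OF eq, of j] by (simp add: simple_refl_apply)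
    then have "u j = i \<and> u (Suc j) = Suc i \<or> u j = Suc i \<and> u (Suc j) = i"
      using inj[of j "Suc j"] by (auto simp: simple_refl_apply split: if_splits)
    then have "inv u i = j \<and> inv u (Suc i) = Suc j \<and> u j = i \<and> u (Suc j) = Suc i \<or>
        inv u i = Suc j \<and> inv u (Suc i) = j \<and> u j = Suc i \<and> u (Suc j) = i"
      using inv(1)[of j] inv(1)[of "Suc j"] by auto
    then show ?thesis by auto
  qed
  assume neq: "simple_refl i \<circ> u \<noteq> u \<circ> simple_refl j"
  then have ne: "{u j, u (Suc j)} \<noteq> {i, Suc i}" using commute by blast
  have "{inv u i, inv u (Suc i)} \<noteq> {j, Suc j}"
  proof
    assume "{inv u i, inv u (Suc i)} = {j, Suc j}"
    then have "u ` {inv u i, inv u (Suc i)} = u ` {j, Suc j}" by simp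
    then show False using ne by (simp add: inv)
  qed
  then show "left_ascent i (u \<circ> simple_refl j) \<longleftrightarrow> left_ascent i u"
    using sym_grp_eq_iff[OF sym_grp_inv[OF u], of i "Suc i"]
    by (simp add: inv_simple_refl_comp(2)[OF sym_grp_bij[OF u]] simple_refl_less_iff)
  show "right_ascent j (simple_refl i \<circ> u) \<longleftrightarrow> right_ascent j u"
    using ne inj[of j "Suc j"] by (simp add: simple_refl_less_iff)
qed

text \<open>This commutation replaces the braid relations: it makes products along reduced words
  independent of the word and the Hecke algebra associative.\<close>

lemma lmul_rmul_commute:
  assumes i: "i \<in> {1..<n}" and j: "j \<in> {1..<n}" and h: "h \<in> hecke_space n"
  shows "lmul i (rmul j h) = rmul j (lmul i h)"
proof (rule hecke_space_eqI[of _ n])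
  fix u assume u: "u \<in> sym_grp n"
  have assoc: "simple_refl i \<circ> u \<circ> simple_refl j = simple_refl i \<circ> (u \<circ> simple_refl j)"
    by (simp add: o_assoc)
  show "lmul i (rmul j h) u = rmul j (lmul i h) u"
  proof (cases "simple_refl i \<circ> u = u \<circ> simple_refl j")
    case True
    have cancel: "simple_refl i \<circ> (u \<circ> simple_refl j) = u" "u \<circ> simple_refl j \<circ> simple_refl j = u"
      using simple_refl_comp_cancel(1)[of i u] True by simp_all
    show ?thesis
      using left_ascent_flip[OF u, of i] right_ascent_flip[OF u, of j]
        ascent_after_opposite_mult(1)[OF u True]
      unfolding lmul_def rmul_def True cancel by (auto simp: algebra_simps simp del: o_apply)
  next
    case False
    show ?thesis
      using ascent_after_opposite_mult(2,3)[OF u False]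
      unfolding lmul_def rmul_def assoc by (auto simp: algebra_simps simp del: o_apply)
  qed
qed (use assms generator_ops_in_hecke_space in blast)+

lemma perm_len_less_left_mult_iff:
  assumes "w \<in> sym_grp n" "i \<in> {1..<n}"
  shows "perm_len w < perm_len (simple_refl i \<circ> w) \<longleftrightarrow> left_ascent i w"
  using perm_len_left_ascent[OF assms(1), of i] perm_len_left_descent[OF assms] by force

lemma gen_mult_basis_apply:
  assumes "w \<in> sym_grp n" "i \<in> {1..<n}"
  shows "gen_mult_basis i w u =
    (if w = simple_refl i \<circ> u then (if left_ascent i w then 1 else q_var) else 0) +
    (if w = u then (if left_ascent i w then 0 else q_var - 1) else 0)"
proof -
  have "u = simple_refl i \<circ> w \<longleftrightarrow> w = simple_refl i \<circ> u" by (metis simple_refl_comp_cancel(1))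
  then show ?thesis
    unfolding gen_mult_basis_def Let_def perm_len_less_left_mult_iff[OF assms] T_elt_def
    by auto
qed

lemma gen_mult_eq_lmul:
  assumes i: "i \<in> {1..<n}" and h: "h \<in> hecke_space n"
  shows "gen_mult n i h = lmul i h"
proof
  fix u :: perm
  define su where "su = simple_refl i \<circ> u"
  have sum: "gen_mult n i h u =
      (\<Sum>w\<in>sym_grp n. if w = su then h w * (if left_ascent i w then 1 else q_var) else 0) +
      (\<Sum>w\<in>sym_grp n. if w = u then h w * (if left_ascent i w then 0 else q_var - 1) else 0)"
    unfolding gen_mult_def sum.distrib[symmetric] su_def
    by (rule sum.cong) (simp_all add: gen_mult_basis_apply[OF _ i] distrib_left)
  show "gen_mult n i h u = lmul i h u"
  proof (cases "u \<in> sym_grp n")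
    case True
    then have "su \<in> sym_grp n" using left_mult_sym_grp_iff[OF i] by (simp add: su_def)
    then show ?thesis
      unfolding sum using True left_ascent_flip[OF True, of i]
      by (simp add: lmul_def su_def[symmetric])
  next
    case False
    then have "su \<notin> sym_grp n" using left_mult_sym_grp_iff[OF i] by (simp add: su_def)
    then show ?thesis
      unfolding sum using False h by (simp add: lmul_def su_def[symmetric] hecke_space_outside)
  qed
qed

lemma lmul_T_elt:
  assumes "w \<in> sym_grp n" "i \<in> {1..<n}" "left_ascent i w"
  shows "lmul i (T_elt w) = T_elt (simple_refl i \<circ> w)"
proof (rule hecke_space_eqI[of _ n])
  fix u assume u: "u \<in> sym_grp n"
  have "simple_refl i \<circ> u = w \<longleftrightarrow> u = simple_refl i \<circ> w" by (metis simple_refl_comp_cancel(1))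
  then show "lmul i (T_elt w) u = T_elt (simple_refl i \<circ> w) u"
    using assms left_ascent_flip[OF assms(1), of i]
    by (auto simp: lmul_def T_elt_def simp del: o_apply)
qed (use assms in \<open>auto simp: generator_ops_in_hecke_space T_elt_in_hecke_space left_mult_sym_grp_iff\<close>)

lemma rmul_T_elt:
  assumes "w \<in> sym_grp n" "i \<in> {1..<n}" "right_ascent i w"
  shows "rmul i (T_elt w) = T_elt (w \<circ> simple_refl i)"
proof (rule hecke_space_eqI[of _ n])
  fix u assume u: "u \<in> sym_grp n"
  have "u \<circ> simple_refl i = w \<longleftrightarrow> u = w \<circ> simple_refl i" by (metis simple_refl_comp_cancel(2))
  then show "rmul i (T_elt w) u = T_elt (w \<circ> simple_refl i) u"
    using assms right_ascent_flip[OF assms(1), of i]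
    by (auto simp: rmul_def T_elt_def simp del: o_apply)
qed (use assms in \<open>auto simp: generator_ops_in_hecke_space T_elt_in_hecke_space right_mult_sym_grp_iff\<close>)

section \<open>Left multiplications and inverses of standard basis elements\<close>

text \<open>Linear endomorphisms of the Hecke algebra, expanded in the standard basis, that commute with
  the multiplications on the right. These are exactly the left multiplications.\<close>

definition left_op :: "nat \<Rightarrow> (hecke_elt \<Rightarrow> hecke_elt) \<Rightarrow> bool" where
  "left_op n X \<longleftrightarrow>
     (\<forall>h\<in>hecke_space n. X h \<in> hecke_space n) \<and>
     (\<forall>h\<in>hecke_space n. \<forall>u. X h u = (\<Sum>w\<in>sym_grp n. h w * X (T_elt w) u)) \<and>
     (\<forall>j\<in>{1..<n}. \<forall>h\<in>hecke_space n. X (rmul j h) = rmul j (X h))"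

lemma left_opI:
  assumes "\<And>h. h \<in> hecke_space n \<Longrightarrow> X h \<in> hecke_space n"
    and "\<And>h u. h \<in> hecke_space n \<Longrightarrow> X h u = (\<Sum>w\<in>sym_grp n. h w * X (T_elt w) u)"
    and "\<And>j h. j \<in> {1..<n} \<Longrightarrow> h \<in> hecke_space n \<Longrightarrow> X (rmul j h) = rmul j (X h)"
  shows "left_op n X"
  unfolding left_op_def using assms by (intro conjI ballI allI)

lemma left_op_closed: "left_op n X \<Longrightarrow> h \<in> hecke_space n \<Longrightarrow> X h \<in> hecke_space n"
  by (simp add: left_op_def)

lemma left_op_expand:
  "left_op n X \<Longrightarrow> h \<in> hecke_space n \<Longrightarrow> X h u = (\<Sum>w\<in>sym_grp n. h w * X (T_elt w) u)"
  unfolding left_op_def by blast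

lemma left_op_rmul:
  "left_op n X \<Longrightarrow> j \<in> {1..<n} \<Longrightarrow> h \<in> hecke_space n \<Longrightarrow> X (rmul j h) = rmul j (X h)"
  unfolding left_op_def by blast

lemma left_op_rmul_inv:
  assumes "left_op n X" "j \<in> {1..<n}" "h \<in> hecke_space n"
  shows "X (rmul_inv j h) = rmul_inv j (X h)"
proof -
  have "rmul_inv j h \<in> hecke_space n" using assms generator_ops_in_hecke_space by blast
  then have "X h = rmul j (X (rmul_inv j h))"
    using left_op_rmul[OF assms(1,2)] generator_inverses(3)[OF assms(2,3)] by metis
  then show ?thesis
    using generator_inverses(4)[OF assms(2)] left_op_closed[OF assms(1)] \<open>rmul_inv j h \<in> _\<close> by metis
qed

text \<open>The right multiplications carry the identity element to every standard basis element, so an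
  operator that commutes with all of them is determined by its value at the identity.\<close>

lemma left_op_eqI:
  assumes X: "left_op n X" and Y: "left_op n Y" and id: "X (T_elt id) = Y (T_elt id)"
    and h: "h \<in> hecke_space n"
  shows "X h = Y h"
proof -
  have basis: "X (T_elt w) = Y (T_elt w)" if "w \<in> sym_grp n" for w
    using that
  proof (induction "perm_len w" arbitrary: w rule: less_induct)
    case less
    show ?case
    proof (cases "w = id")
      case False
      then obtain j where j: "j \<in> {1..<n}" "\<not> right_ascent j w"
        using no_descent_imp_id[OF less.prems] by blast
      define v where "v = w \<circ> simple_refl j"
      have v: "v \<in> sym_grp n" "right_ascent j v" "w = v \<circ> simple_refl j"
        unfolding v_def using less.prems right_mult_sym_grp_iff[OF j(1)]
          right_ascent_flip[OF less.prems, of j] j(2) by simp_all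
      have "perm_len v < perm_len w" using perm_len_right_ascent[OF v(1) j(1) v(2)] v(3) by simp
      then have "X (T_elt v) = Y (T_elt v)" using less.hyps v(1) by blast
      moreover have "T_elt w = rmul j (T_elt v)" using rmul_T_elt[OF v(1) j(1) v(2)] v(3) by simp
      ultimately show ?thesis
        using left_op_rmul[OF X j(1)] left_op_rmul[OF Y j(1)] T_elt_in_hecke_space[OF v(1)] by simp
    qed (simp add: id)
  qed
  show ?thesis
    by (rule ext) (simp add: left_op_expand[OF X h] left_op_expand[OF Y h] basis)
qed

lemma T_elt_expand:
  "h \<in> hecke_space n \<Longrightarrow> h u = (\<Sum>w\<in>sym_grp n. h w * T_elt w u)"
  by (cases "u \<in> sym_grp n") (auto simp: T_elt_def hecke_space_outside if_distrib cong: if_cong)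

lemma left_op_id: "left_op n (\<lambda>h. h)"
  by (rule left_opI) (rule T_elt_expand | assumption | rule refl)+

lemma left_op_lmul:
  assumes i: "i \<in> {1..<n}"
  shows "left_op n (lmul i)"
proof -
  have basis: "lmul i (T_elt w) u = gen_mult_basis i w u" if w: "w \<in> sym_grp n" for w u
  proof -
    have "lmul i (T_elt w) u = (\<Sum>v\<in>sym_grp n. T_elt w v * gen_mult_basis i v u)"
      using gen_mult_eq_lmul[OF i T_elt_in_hecke_space[OF w]] unfolding gen_mult_def by metis
    also have "\<dots> = (\<Sum>v\<in>sym_grp n. if v = w then gen_mult_basis i v u else 0)"
      by (rule sum.cong) (simp_all add: T_elt_def)
    finally show ?thesis using w by simp
  qed
  have "lmul i h u = (\<Sum>w\<in>sym_grp n. h w * lmul i (T_elt w) u)" if h: "h \<in> hecke_space n" for h u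
  proof -
    have "lmul i h u = (\<Sum>w\<in>sym_grp n. h w * gen_mult_basis i w u)"
      using gen_mult_eq_lmul[OF i h] unfolding gen_mult_def by metis
    then show ?thesis by (simp add: basis)
  qed
  then show ?thesis
    using generator_ops_in_hecke_space(1)[OF i] lmul_rmul_commute[OF i] by (intro left_opI)
qed

lemma left_op_comp:
  assumes X: "left_op n X" and Y: "left_op n Y"
  shows "left_op n (\<lambda>h. X (Y h))"
proof -
  have "X (Y h) u = (\<Sum>v\<in>sym_grp n. h v * X (Y (T_elt v)) u)" if h: "h \<in> hecke_space n" for h u
  proof -
    have "X (Y h) u = (\<Sum>w\<in>sym_grp n. Y h w * X (T_elt w) u)"
      by (rule left_op_expand[OF X left_op_closed[OF Y h]])
    also have "\<dots> = (\<Sum>w\<in>sym_grp n. \<Sum>v\<in>sym_grp n. h v * (Y (T_elt v) w * X (T_elt w) u))"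
      by (simp add: left_op_expand[OF Y h] sum_distrib_right mult.assoc)
    also have "\<dots> = (\<Sum>v\<in>sym_grp n. h v * (\<Sum>w\<in>sym_grp n. Y (T_elt v) w * X (T_elt w) u))"
      by (subst sum.swap) (simp add: sum_distrib_left)
    also have "\<dots> = (\<Sum>v\<in>sym_grp n. h v * X (Y (T_elt v)) u)"
      by (rule sum.cong) (simp_all add: left_op_expand[OF X left_op_closed[OF Y T_elt_in_hecke_space]])
    finally show ?thesis .
  qed
  moreover have "X (Y (rmul j h)) = rmul j (X (Y h))" if "j \<in> {1..<n}" "h \<in> hecke_space n" for j h
    using left_op_rmul[OF Y that] left_op_rmul[OF X that(1) left_op_closed[OF Y that(2)]] by simp
  ultimately show ?thesis
    using left_op_closed[OF X left_op_closed[OF Y]] by (intro left_opI)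
qed

lemma left_op_sum:
  assumes X: "\<And>a. a \<in> A \<Longrightarrow> left_op n (X a)"
  shows "left_op n (\<lambda>h u. \<Sum>a\<in>A. c a * X a h u)"
proof -
  have "(\<lambda>u. \<Sum>a\<in>A. c a * X a h u) \<in> hecke_space n" if "h \<in> hecke_space n" for h
    using left_op_closed[OF X that] by (simp add: hecke_space_iff)
  moreover have "(\<Sum>a\<in>A. c a * X a h u) = (\<Sum>w\<in>sym_grp n. h w * (\<Sum>a\<in>A. c a * X a (T_elt w) u))"
    if "h \<in> hecke_space n" for h u
    unfolding sum_distrib_left
    by (subst sum.swap, rule sum.cong)
      (simp_all add: left_op_expand[OF X that] sum_distrib_left mult.left_commute)
  moreover have "(\<lambda>u. \<Sum>a\<in>A. c a * X a (rmul j h) u) = rmul j (\<lambda>u. \<Sum>a\<in>A. c a * X a h u)"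
    if "j \<in> {1..<n}" "h \<in> hecke_space n" for j h
  proof -
    have "(\<lambda>u. \<Sum>a\<in>A. c a * X a (rmul j h) u) = (\<lambda>u. \<Sum>a\<in>A. c a * rmul j (X a h) u)"
      by (simp add: left_op_rmul[OF X that])
    also have "\<dots> = rmul j (\<lambda>u. \<Sum>a\<in>A. c a * X a h u)"
      by (simp add: rmul_def fun_eq_iff sum_distrib_left sum.distrib[symmetric] algebra_simps
          del: o_apply)
    finally show ?thesis .
  qed
  ultimately show ?thesis by (rule left_opI)
qed

lemma left_op_lmul_inv:
  assumes i: "i \<in> {1..<n}"
  shows "left_op n (lmul_inv i)"
proof -
  have "lmul_inv i = (\<lambda>h u. \<Sum>b\<in>(UNIV :: bool set).
      (if b then q_inv else q_inv - 1) * (if b then lmul i else (\<lambda>h. h)) h u)"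
    by (simp add: UNIV_bool lmul_def lmul_inv_def fun_eq_iff algebra_simps del: o_apply)
  then show ?thesis
    using left_op_sum[of "UNIV :: bool set" n "\<lambda>b. if b then lmul i else (\<lambda>h. h)"]
      left_op_lmul[OF i] left_op_id by simp
qed

lemma left_op_foldr:
  assumes "\<And>i. i \<in> {1..<n} \<Longrightarrow> left_op n (F i)" "set ws \<subseteq> {1..<n}"
  shows "left_op n (foldr F ws)"
  using assms(2)
proof (induction ws)
  case Nil
  then show ?case using left_op_id by (simp add: id_def)
next
  case (Cons i ws)
  then show ?case using left_op_comp[OF assms(1)[of i], of "foldr F ws"] by (simp add: o_def)
qed

lemma left_op_words:
  assumes "set ws \<subseteq> {1..<n}"
  shows "left_op n (foldr lmul ws)" "left_op n (foldr lmul_inv ws)"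
  by (rule left_op_foldr[OF _ assms], erule left_op_lmul)
    (rule left_op_foldr[OF _ assms], erule left_op_lmul_inv)

primrec word_perm :: "nat list \<Rightarrow> perm" where
  "word_perm [] = id"
| "word_perm (i # ws) = simple_refl i \<circ> word_perm ws"

lemma reduced_word_iff:
  "reduced_word n ws w \<longleftrightarrow> set ws \<subseteq> {1..<n} \<and> length ws = perm_len w \<and> word_perm ws = w"
proof -
  have "foldr (\<lambda>i u. simple_refl i \<circ> u) ws id = word_perm ws" by (induction ws) simp_all
  then show ?thesis unfolding reduced_word_def by simp
qed

lemma word_perm_sym_grp: "set ws \<subseteq> {1..<n} \<Longrightarrow> word_perm ws \<in> sym_grp n"
  by (induction ws) (simp_all add: left_mult_sym_grp_iff)

lemma word_perm_append: "word_perm (xs @ ys) = word_perm xs \<circ> word_perm ys"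
  by (induction xs) (simp_all add: o_assoc)

lemma word_perm_rev: "set ws \<subseteq> {1..<n} \<Longrightarrow> word_perm (rev ws) = inv (word_perm ws)"
proof (induction ws)
  case (Cons i ws)
  then have "bij (word_perm ws)" using sym_grp_bij[OF word_perm_sym_grp[of ws n]] by simp
  then have "inv (word_perm (i # ws)) = inv (word_perm ws) \<circ> simple_refl i"
    unfolding word_perm.simps by (rule inv_simple_refl_comp)
  moreover have "word_perm (rev (i # ws)) = word_perm (rev ws) \<circ> simple_refl i"
    unfolding rev.simps word_perm_append word_perm.simps comp_id ..
  moreover have "word_perm (rev ws) = inv (word_perm ws)" using Cons by simp
  ultimately show ?case by (simp only:)
qed simp

lemma reduced_word_sym_grp: "reduced_word n ws w \<Longrightarrow> w \<in> sym_grp n"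
  using word_perm_sym_grp by (auto simp: reduced_word_iff)

lemma perm_len_left_mult_le:
  assumes "w \<in> sym_grp n" "i \<in> {1..<n}"
  shows "perm_len (simple_refl i \<circ> w) \<le> Suc (perm_len w)"
  using perm_len_left_ascent[OF assms(1), of i] perm_len_left_descent[OF assms]
  by (cases "left_ascent i w") linarith+

lemma perm_len_word_le: "set ws \<subseteq> {1..<n} \<Longrightarrow> perm_len (word_perm ws) \<le> length ws"
proof (induction ws)
  case (Cons i ws)
  then have "perm_len (word_perm (i # ws)) \<le> Suc (perm_len (word_perm ws))"
    unfolding word_perm.simps
    by (intro perm_len_left_mult_le[of _ n] word_perm_sym_grp) simp_all
  also have "\<dots> \<le> length (i # ws)" using Cons by simp
  finally show ?case .
qed simp

lemma reduced_word_Cons: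
  assumes "reduced_word n (i # ws) w"
  shows "i \<in> {1..<n}" "reduced_word n ws (simple_refl i \<circ> w)" "left_ascent i (simple_refl i \<circ> w)"
proof -
  show i: "i \<in> {1..<n}" using assms by (simp add: reduced_word_iff)
  have w: "simple_refl i \<circ> word_perm ws = w" and ws: "set ws \<subseteq> {1..<n}"
    and len: "perm_len w = Suc (length ws)"
    using assms by (simp_all add: reduced_word_iff)
  have v: "simple_refl i \<circ> w = word_perm ws" unfolding w[symmetric] by simp
  note mem = word_perm_sym_grp[OF ws]
  show asc: "left_ascent i (simple_refl i \<circ> w)"
  proof (rule ccontr)
    assume "\<not> left_ascent i (simple_refl i \<circ> w)"
    then have "perm_len (word_perm ws) = Suc (perm_len w)"
      using perm_len_left_descent[OF mem i] unfolding v w by blast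
    then show False using perm_len_word_le[OF ws] len by simp
  qed
  then have "perm_len w = Suc (perm_len (word_perm ws))"
    using perm_len_left_ascent[OF mem, of i] unfolding v w by blast
  then show "reduced_word n ws (simple_refl i \<circ> w)"
    unfolding v using ws len by (simp add: reduced_word_iff)
qed

lemma reduced_word_left_ascent:
  "reduced_word n ws w \<Longrightarrow> i \<in> {1..<n} \<Longrightarrow> left_ascent i w \<Longrightarrow>
   reduced_word n (i # ws) (simple_refl i \<circ> w)"
  using perm_len_left_ascent[OF reduced_word_sym_grp] by (auto simp: reduced_word_iff)

lemma reduced_word_right_ascent:
  assumes "reduced_word n ws w" "i \<in> {1..<n}" "right_ascent i w"
  shows "reduced_word n (ws @ [i]) (w \<circ> simple_refl i)"
  using assms perm_len_right_ascent[OF reduced_word_sym_grp[OF assms(1)] assms(2,3)]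
  unfolding reduced_word_iff word_perm_append by auto

lemma reduced_word_rev: "reduced_word n ws w \<Longrightarrow> reduced_word n (rev ws) (inv w)"
  using perm_len_inv[OF reduced_word_sym_grp, of n ws w] word_perm_rev[of ws n]
  by (auto simp: reduced_word_iff)

lemma lmul_word_T_id:
  "reduced_word n ws w \<Longrightarrow> foldr lmul ws (T_elt id) = T_elt w"
proof (induction ws arbitrary: w)
  case Nil
  then show ?case by (simp add: reduced_word_iff)
next
  case (Cons i ws)
  note r = reduced_word_Cons[OF Cons.prems]
  have "foldr lmul (i # ws) (T_elt id) = lmul i (T_elt (simple_refl i \<circ> w))"
    unfolding foldr_Cons o_apply Cons.IH[OF r(2)] ..
  also have "\<dots> = T_elt w"
    unfolding lmul_T_elt[OF reduced_word_sym_grp[OF r(2)] r(1,3)] simple_refl_comp_cancel(1) ..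
  finally show ?case .
qed

text \<open>Two reduced words of w give operators with the same value \<open>T\<^sub>w\<close> at the identity, hence equal
  operators.\<close>

lemma T_mult_eq_lmul_word:
  assumes ws: "reduced_word n ws w" and h: "h \<in> hecke_space n"
  shows "T_mult n w h = foldr lmul ws h"
proof -
  define vs where "vs = (SOME vs. reduced_word n vs w)"
  have vs: "reduced_word n vs w" unfolding vs_def using ws by (rule someI)
  have "foldr (gen_mult n) xs h = foldr lmul xs h \<and> foldr lmul xs h \<in> hecke_space n"
    if "set xs \<subseteq> {1..<n}" for xs
    using that by (induction xs) (simp_all add: h gen_mult_eq_lmul generator_ops_in_hecke_space)
  then have "T_mult n w h = foldr lmul vs h"
    using vs unfolding T_mult_def vs_def[symmetric] by (simp add: reduced_word_iff)
  moreover have "foldr lmul vs h = foldr lmul ws h"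
  proof (rule left_op_eqI[of n "foldr lmul vs" "foldr lmul ws"])
    show "left_op n (foldr lmul vs)" "left_op n (foldr lmul ws)"
      using vs ws left_op_words(1) unfolding reduced_word_iff by blast+
    show "foldr lmul vs (T_elt id) = foldr lmul ws (T_elt id)"
      unfolding lmul_word_T_id[OF vs] lmul_word_T_id[OF ws] ..
  qed (rule h)
  ultimately show ?thesis by simp
qed

lemma left_op_T_mult:
  assumes "w \<in> sym_grp n"
  shows "left_op n (T_mult n w)"
proof -
  obtain ws where ws: "reduced_word n ws w" using reduced_word_exists_sym_grp[OF assms] by blast
  then have op: "left_op n (foldr lmul ws)"
    unfolding reduced_word_iff using left_op_words(1) by blast
  note eq = T_mult_eq_lmul_word[OF ws]
  show ?thesis
  proof (rule left_opI)
    fix h u j assume h: "h \<in> hecke_space n"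
    show "T_mult n w h \<in> hecke_space n"
      unfolding eq[OF h] by (rule left_op_closed[OF op h])
    show "T_mult n w h u = (\<Sum>v\<in>sym_grp n. h v * T_mult n w (T_elt v) u)"
      unfolding eq[OF h] left_op_expand[OF op h]
      by (rule sum.cong) (simp_all add: eq T_elt_in_hecke_space)
    show "T_mult n w (rmul j h) = rmul j (T_mult n w h)" if j: "j \<in> {1..<n}"
      unfolding eq[OF h] eq[OF generator_ops_in_hecke_space(2)[OF j h]]
      by (rule left_op_rmul[OF op j h])
  qed
qed

lemma lmul_word_inverse:
  assumes "set ws \<subseteq> {1..<n}" "h \<in> hecke_space n"
  shows "foldr lmul (rev ws) (foldr lmul_inv ws h) = h"
    and "foldr lmul_inv ws (foldr lmul (rev ws) h) = h"
proof -
  show "foldr lmul (rev ws) (foldr lmul_inv ws h) = h"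
    using assms
  proof (induction ws)
    case (Cons i ws)
    have "foldr lmul_inv ws h \<in> hecke_space n"
      using left_op_closed[OF left_op_words(2)] Cons.prems by simp
    then show ?case using Cons generator_inverses(1)[of i n] by simp
  qed simp
  show "foldr lmul_inv ws (foldr lmul (rev ws) h) = h"
    using assms
  proof (induction ws arbitrary: h)
    case (Cons i ws)
    then have "lmul i h \<in> hecke_space n" by (simp add: generator_ops_in_hecke_space)
    then show ?case using Cons generator_inverses(2)[of i n] by simp
  qed simp
qed

lemma hecke_mult: "mult (hecke n) a b = (\<lambda>u. \<Sum>w\<in>sym_grp n. a w * T_mult n w b u)"
  and hecke_one: "one (hecke n) = T_elt id"
  by (simp_all add: hecke_def)

lemma hecke_mult_T_elt:
  assumes "w \<in> sym_grp n"
  shows "mult (hecke n) (T_elt w) h = T_mult n w h"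
proof
  fix u
  have "mult (hecke n) (T_elt w) h u = (\<Sum>v\<in>sym_grp n. if v = w then T_mult n v h u else 0)"
    unfolding hecke_mult by (rule sum.cong) (simp_all add: T_elt_def)
  then show "mult (hecke n) (T_elt w) h u = T_mult n w h u" using assms by simp
qed

text \<open>The image of the basis element at w under the bar involution.\<close>

abbreviation T_dual :: "nat \<Rightarrow> perm \<Rightarrow> hecke_elt" where
  "T_dual n w \<equiv> m_inv (hecke n) (T_elt (inv w))"

text \<open>With w written as a reduced word, the inverse of the basis element at the inverse of w is the
  product of the inverse generators in the same order. That the candidate is also a left inverse
  needs associativity, here in the form that left multiplications are determined by their value
  at the identity.\<close>

lemma T_dual_eq_lmul_inv_word:
  assumes ws: "reduced_word n ws w"
  shows "T_dual n w = foldr lmul_inv ws (T_elt id)"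
proof -
  define a b where "a = T_elt (inv w)" and "b = foldr lmul_inv ws (T_elt id)"
  have set: "set ws \<subseteq> {1..<n}" using ws by (simp add: reduced_word_iff)
  have w: "inv w \<in> sym_grp n" using reduced_word_sym_grp[OF ws] by (rule sym_grp_inv)
  note one = T_elt_in_hecke_space[OF sym_grp_id, of n]
  have a: "a \<in> hecke_space n" unfolding a_def by (rule T_elt_in_hecke_space[OF w])
  have op: "left_op n (foldr lmul_inv ws)" by (rule left_op_words(2)[OF set])
  have b: "b \<in> hecke_space n" unfolding b_def by (rule left_op_closed[OF op one])
  have left: "mult (hecke n) a y = foldr lmul (rev ws) y" if "y \<in> hecke_space n" for y
    unfolding a_def hecke_mult_T_elt[OF w]
    by (rule T_mult_eq_lmul_word[OF reduced_word_rev[OF ws] that])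
  have right: "mult (hecke n) b a = T_elt id"
  proof -
    \<comment> \<open>Multiplication by b and the inverse word are both left multiplications with value b at
      the identity.\<close>
    have opb: "left_op n (mult (hecke n) b)"
      unfolding hecke_mult by (rule left_op_sum) (rule left_op_T_mult)
    have T_mult_id: "T_mult n v (T_elt id) = T_elt v" if v: "v \<in> sym_grp n" for v
    proof -
      obtain vs where vs: "reduced_word n vs v" using reduced_word_exists_sym_grp[OF v] by blast
      show ?thesis unfolding T_mult_eq_lmul_word[OF vs one] by (rule lmul_word_T_id[OF vs])
    qed
    have "mult (hecke n) b (T_elt id) = b"
    proof
      fix u
      have "mult (hecke n) b (T_elt id) u = (\<Sum>w\<in>sym_grp n. b w * T_elt w u)"
        unfolding hecke_mult by (rule sum.cong) (simp_all add: T_mult_id)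
      also have "\<dots> = b u" by (rule T_elt_expand[OF b, symmetric])
      finally show "mult (hecke n) b (T_elt id) u = b u" .
    qed
    then have "mult (hecke n) b a = foldr lmul_inv ws a"
      unfolding b_def by (rule left_op_eqI[OF opb[unfolded b_def] op _ a])
    also have "\<dots> = foldr lmul_inv ws (foldr lmul (rev ws) (T_elt id))"
      unfolding a_def lmul_word_T_id[OF reduced_word_rev[OF ws]] ..
    also have "\<dots> = T_elt id" by (rule lmul_word_inverse(2)[OF set one])
    finally show ?thesis .
  qed
  have "m_inv (hecke n) a = b"
    unfolding m_inv_def
  proof (rule the_equality)
    have "mult (hecke n) a b = T_elt id"
      unfolding left[OF b] unfolding b_def by (rule lmul_word_inverse(1)[OF set one])
    then show "b \<in> hecke_space n \<and> mult (hecke n) a b = one (hecke n) \<and>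
      mult (hecke n) b a = one (hecke n)"
      using b right unfolding hecke_one by blast
    fix y
    assume y: "y \<in> hecke_space n \<and> mult (hecke n) a y = one (hecke n) \<and>
      mult (hecke n) y a = one (hecke n)"
    then have "foldr lmul (rev ws) y = T_elt id" using left[of y] unfolding hecke_one by metis
    then show "y = b" unfolding b_def using lmul_word_inverse(2)[OF set, of y] y by metis
  qed
  then show ?thesis unfolding a_def b_def .
qed


lemma T_dual_in_hecke_space:
  assumes "w \<in> sym_grp n"
  shows "T_dual n w \<in> hecke_space n"
proof -
  obtain ws where ws: "reduced_word n ws w" using reduced_word_exists_sym_grp[OF assms] by blast
  then have "left_op n (foldr lmul_inv ws)"
    unfolding reduced_word_iff using left_op_words(2) by blast
  then show ?thesis
    unfolding T_dual_eq_lmul_inv_word[OF ws] by (rule left_op_closed) (simp add: T_elt_in_hecke_space)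
qed

lemma T_dual_left:
  assumes "w \<in> sym_grp n" "i \<in> {1..<n}" "left_ascent i w"
  shows "T_dual n (simple_refl i \<circ> w) = lmul_inv i (T_dual n w)"
proof -
  obtain ws where ws: "reduced_word n ws w" using reduced_word_exists_sym_grp[OF assms(1)] by blast
  show ?thesis
    unfolding T_dual_eq_lmul_inv_word[OF ws]
      T_dual_eq_lmul_inv_word[OF reduced_word_left_ascent[OF ws assms(2,3)]] by simp
qed

lemma T_dual_right:
  assumes "w \<in> sym_grp n" "i \<in> {1..<n}" "right_ascent i w"
  shows "T_dual n (w \<circ> simple_refl i) = rmul_inv i (T_dual n w)"
proof -
  obtain ws where ws: "reduced_word n ws w" using reduced_word_exists_sym_grp[OF assms(1)] by blast
  then have op: "left_op n (foldr lmul_inv ws)"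
    unfolding reduced_word_iff using left_op_words(2) by blast
  note one = T_elt_in_hecke_space[OF sym_grp_id, of n]
  have "lmul_inv i (T_elt id) = rmul_inv i (T_elt id)"
  proof
    fix u :: perm
    have s: "simple_refl i \<circ> u = id \<longleftrightarrow> u = simple_refl i" "u \<circ> simple_refl i = id \<longleftrightarrow> u = simple_refl i"
      by (metis comp_id simple_refl_comp_cancel(1)) (metis id_comp simple_refl_comp_cancel(2))
    show "lmul_inv i (T_elt id) u = rmul_inv i (T_elt id) u"
    proof (cases "u = id \<or> u = simple_refl i")
      case True
      then have "left_ascent i u \<longleftrightarrow> right_ascent i u" by (auto simp: inv_id)
      then show ?thesis unfolding lmul_inv_def rmul_inv_def T_elt_def s by simp
    next
      case False
      then show ?thesis unfolding lmul_inv_def rmul_inv_def T_elt_def s by simp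
    qed
  qed
  then show ?thesis
    unfolding T_dual_eq_lmul_inv_word[OF ws]
      T_dual_eq_lmul_inv_word[OF reduced_word_right_ascent[OF ws assms(2,3)]]
    by (simp add: left_op_rmul_inv[OF op assms(2) one])
qed

section \<open>The bar involution\<close>

lemma hecke_bar_v_pow_mult:
  "hecke_bar n (\<lambda>u. v_pow k * h u) = (\<lambda>u. v_pow (- k) * hecke_bar n h u)"
  by (simp add: hecke_bar_def laurent_bar_v_pow_mult sum_distrib_left mult.assoc)

lemma hecke_bar_add: "hecke_bar n (\<lambda>u. g u + h u) = (\<lambda>u. hecke_bar n g u + hecke_bar n h u)"
  by (simp add: hecke_bar_def laurent_bar_add distrib_right sum.distrib)

text \<open>Moving a quadratic relation from the coefficients to the basis: re-index the terms with
  \<open>f (\<sigma> w)\<close> along the involution \<open>\<sigma>\<close>, which exchanges ascents and descents.\<close>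

lemma sum_involution_adjoint:
  fixes f B :: "'b \<Rightarrow> 'a :: comm_ring_1"
  assumes "\<And>w. w \<in> S \<Longrightarrow> \<sigma> w \<in> S" "\<And>w. w \<in> S \<Longrightarrow> \<sigma> (\<sigma> w) = w"
    and "\<And>w. w \<in> S \<Longrightarrow> A (\<sigma> w) \<longleftrightarrow> \<not> A w"
  shows "(\<Sum>w\<in>S. (if A w then a * f (\<sigma> w) else f (\<sigma> w) + (a - 1) * f w) * B w) =
    (\<Sum>w\<in>S. f w * (if A w then B (\<sigma> w) else (a - 1) * B w + a * B (\<sigma> w)))"
proof -
  have "(\<Sum>w\<in>S. (if A w then a else 1) * f (\<sigma> w) * B w) =
      (\<Sum>w\<in>S. (if A w then 1 else a) * f w * B (\<sigma> w))"
    by (rule sum.reindex_bij_witness[of _ \<sigma> \<sigma>]) (use assms in auto)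
  moreover have "(\<Sum>w\<in>S. (if A w then a * f (\<sigma> w) else f (\<sigma> w) + (a - 1) * f w) * B w) =
      (\<Sum>w\<in>S. (if A w then a else 1) * f (\<sigma> w) * B w) +
      (\<Sum>w\<in>S. (if A w then 0 else a - 1) * f w * B w)"
    unfolding sum.distrib[symmetric] by (rule sum.cong) (auto simp: algebra_simps)
  moreover have "(\<Sum>w\<in>S. f w * (if A w then B (\<sigma> w) else (a - 1) * B w + a * B (\<sigma> w))) =
      (\<Sum>w\<in>S. (if A w then 1 else a) * f w * B (\<sigma> w)) +
      (\<Sum>w\<in>S. (if A w then 0 else a - 1) * f w * B w)"
    unfolding sum.distrib[symmetric] by (rule sum.cong) (auto simp: algebra_simps)
  ultimately show ?thesis by simp
qed

lemma generator_inv_quadratic: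
  assumes "h \<in> hecke_space n" "i \<in> {1..<n}"
  shows "lmul_inv i (lmul_inv i h) = (\<lambda>u. (q_inv - 1) * lmul_inv i h u + q_inv * h u)"
    and "rmul_inv i (rmul_inv i h) = (\<lambda>u. (q_inv - 1) * rmul_inv i h u + q_inv * h u)"
proof -
  note closed = generator_ops_in_hecke_space[OF assms(2)]
  show "lmul_inv i (lmul_inv i h) = (\<lambda>u. (q_inv - 1) * lmul_inv i h u + q_inv * h u)"
  proof (rule hecke_space_eqI[of _ n])
    show "(\<lambda>u. (q_inv - 1) * lmul_inv i h u + q_inv * h u) \<in> hecke_space n"
      using closed(3)[OF assms(1)] assms(1) by (simp add: hecke_space_iff)
    fix u assume "u \<in> sym_grp n"
    from left_ascent_flip[OF this, of i]
    show "lmul_inv i (lmul_inv i h) u = (q_inv - 1) * lmul_inv i h u + q_inv * h u"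
      by (simp add: lmul_inv_def algebra_simps del: o_apply)
  qed (intro closed assms)
  show "rmul_inv i (rmul_inv i h) = (\<lambda>u. (q_inv - 1) * rmul_inv i h u + q_inv * h u)"
  proof (rule hecke_space_eqI[of _ n])
    show "(\<lambda>u. (q_inv - 1) * rmul_inv i h u + q_inv * h u) \<in> hecke_space n"
      using closed(4)[OF assms(1)] assms(1) by (simp add: hecke_space_iff)
    fix u assume "u \<in> sym_grp n"
    from right_ascent_flip[OF this, of i]
    show "rmul_inv i (rmul_inv i h) u = (q_inv - 1) * rmul_inv i h u + q_inv * h u"
      by (simp add: rmul_inv_def algebra_simps del: o_apply)
  qed (intro closed assms)
qed

lemma lmul_inv_T_dual:
  assumes w: "w \<in> sym_grp n" and i: "i \<in> {1..<n}"
  shows "lmul_inv i (T_dual n w) u = (if left_ascent i w then T_dual n (simple_refl i \<circ> w) u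
    else (q_inv - 1) * T_dual n w u + q_inv * T_dual n (simple_refl i \<circ> w) u)"
proof (cases "left_ascent i w")
  case True
  then show ?thesis by (simp only: T_dual_left[OF w i] if_True)
next
  case False
  define v where "v = simple_refl i \<circ> w"
  have v: "v \<in> sym_grp n" "left_ascent i v" and wv: "w = simple_refl i \<circ> v"
    using w left_mult_sym_grp_iff[OF i] left_ascent_flip[OF w, of i] False
    unfolding v_def simple_refl_comp_cancel(1) by blast+
  have "T_dual n w = lmul_inv i (T_dual n v)" unfolding wv by (rule T_dual_left[OF v(1) i v(2)])
  then have "lmul_inv i (T_dual n w) u = (q_inv - 1) * T_dual n w u + q_inv * T_dual n v u"
    using generator_inv_quadratic(1)[OF T_dual_in_hecke_space[OF v(1)] i] by simp
  then show ?thesis using False unfolding v_def by (simp only: if_False)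
qed

lemma rmul_inv_T_dual:
  assumes w: "w \<in> sym_grp n" and i: "i \<in> {1..<n}"
  shows "rmul_inv i (T_dual n w) u = (if right_ascent i w then T_dual n (w \<circ> simple_refl i) u
    else (q_inv - 1) * T_dual n w u + q_inv * T_dual n (w \<circ> simple_refl i) u)"
proof (cases "right_ascent i w")
  case True
  then show ?thesis by (simp only: T_dual_right[OF w i] if_True)
next
  case False
  define v where "v = w \<circ> simple_refl i"
  have v: "v \<in> sym_grp n" "right_ascent i v" and wv: "w = v \<circ> simple_refl i"
    using w right_mult_sym_grp_iff[OF i] right_ascent_flip[OF w, of i] False
    unfolding v_def simple_refl_comp_cancel(2) by blast+
  have "T_dual n w = rmul_inv i (T_dual n v)" unfolding wv by (rule T_dual_right[OF v(1) i v(2)])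
  then have "rmul_inv i (T_dual n w) u = (q_inv - 1) * T_dual n w u + q_inv * T_dual n v u"
    using generator_inv_quadratic(2)[OF T_dual_in_hecke_space[OF v(1)] i] by simp
  then show ?thesis using False unfolding v_def by (simp only: if_False)
qed

text \<open>The bar involution inverts multiplication by \<open>T\<^sub>s\<close> on either side, because the images of the
  standard basis elements satisfy the relations of the standard basis with \<open>T\<^sub>s\<close> and q replaced by
  their inverses.\<close>

lemma hecke_bar_lmul:
  assumes i: "i \<in> {1..<n}"
  shows "hecke_bar n (lmul i h) = lmul_inv i (hecke_bar n h)"
proof
  fix u
  define f where "f w = laurent_bar (h w)" for w
  have coeff: "laurent_bar (lmul i h w) = (if left_ascent i w then q_inv * f (simple_refl i \<circ> w)
      else f (simple_refl i \<circ> w) + (q_inv - 1) * f w)" for w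
    by (simp add: lmul_def f_def laurent_bar_add laurent_bar_q_mult left_diff_distrib
        laurent_bar_diff del: o_apply)
  have "hecke_bar n (lmul i h) u = (\<Sum>w\<in>sym_grp n. f w * lmul_inv i (T_dual n w) u)"
    unfolding hecke_bar_def coeff
    by (subst sum_involution_adjoint[where \<sigma> = "\<lambda>w. simple_refl i \<circ> w"])
      (simp_all add: left_mult_sym_grp_iff[OF i] left_ascent_flip lmul_inv_T_dual[OF _ i] del: o_apply)
  also have "\<dots> = lmul_inv i (hecke_bar n h) u"
    by (simp add: lmul_inv_def hecke_bar_def f_def sum_distrib_left sum.distrib[symmetric]
        algebra_simps del: o_apply)
  finally show "hecke_bar n (lmul i h) u = lmul_inv i (hecke_bar n h) u" .
qed

lemma hecke_bar_rmul:
  assumes i: "i \<in> {1..<n}"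
  shows "hecke_bar n (rmul i h) = rmul_inv i (hecke_bar n h)"
proof
  fix u
  define f where "f w = laurent_bar (h w)" for w
  have coeff: "laurent_bar (rmul i h w) = (if right_ascent i w then q_inv * f (w \<circ> simple_refl i)
      else f (w \<circ> simple_refl i) + (q_inv - 1) * f w)" for w
    by (simp add: rmul_def f_def laurent_bar_add laurent_bar_q_mult left_diff_distrib
        laurent_bar_diff del: o_apply)
  have "hecke_bar n (rmul i h) u = (\<Sum>w\<in>sym_grp n. f w * rmul_inv i (T_dual n w) u)"
    unfolding hecke_bar_def coeff
    by (subst sum_involution_adjoint[where \<sigma> = "\<lambda>w. w \<circ> simple_refl i"])
      (simp_all add: right_mult_sym_grp_iff[OF i] right_ascent_flip rmul_inv_T_dual[OF _ i] del: o_apply)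
  also have "\<dots> = rmul_inv i (hecke_bar n h) u"
    by (simp add: rmul_inv_def hecke_bar_def f_def sum_distrib_left sum.distrib[symmetric]
        algebra_simps del: o_apply)
  finally show "hecke_bar n (rmul i h) u = rmul_inv i (hecke_bar n h) u" .
qed

section \<open>Triangularity and uniqueness of the Kazhdan--Lusztig family\<close>

text \<open>Multiplication by \<open>T\<^sub>s\<inverse>\<close> lengthens by at most one, and the coefficient of the new longest term
  acquires the factor \<open>q\<inverse>\<close>.\<close>

lemma T_dual_triangular:
  assumes "w \<in> sym_grp n" "u \<in> sym_grp n" "perm_len w \<le> perm_len u"
  shows "T_dual n w u = (if u = w then v_pow (- 2 * int (perm_len w)) else 0)"
proof -
  obtain ws where "reduced_word n ws w" using reduced_word_exists_sym_grp[OF assms(1)] by blast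
  then show ?thesis
    using assms(2,3)
  proof (induction ws arbitrary: w u)
    case Nil
    then have w: "w = id" by (simp add: reduced_word_iff)
    have "T_dual n w u = T_elt id u" unfolding T_dual_eq_lmul_inv_word[OF Nil.prems(1)] by simp
    also have "\<dots> = (if u = w then v_pow (- 2 * int (perm_len w)) else 0)"
      unfolding w perm_len_id T_elt_def by simp
    finally show ?case .
  next
    case (Cons i ws)
    note r = reduced_word_Cons[OF Cons.prems(1)]
    define v where "v = simple_refl i \<circ> w"
    have w: "w = simple_refl i \<circ> v" unfolding v_def by simp
    have v: "v \<in> sym_grp n" "left_ascent i v" using r reduced_word_sym_grp unfolding v_def by blast+
    have lw: "perm_len w = Suc (perm_len v)"
      unfolding w by (rule perm_len_left_ascent[OF v])
    have IH: "T_dual n v x = (if x = v then v_pow (- 2 * int (perm_len v)) else 0)"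
      if "x \<in> sym_grp n" "perm_len v \<le> perm_len x" for x
      using Cons.IH[OF r(2)] that unfolding v_def by blast
    have rec: "T_dual n w = lmul_inv i (T_dual n v)" unfolding w by (rule T_dual_left[OF v(1) r(1) v(2)])
    have u0: "T_dual n v u = 0"
      using IH[OF Cons.prems(2)] Cons.prems(3) lw by (cases "u = v") simp_all
    have su: "simple_refl i \<circ> u \<in> sym_grp n" using Cons.prems(2) left_mult_sym_grp_iff[OF r(1)] by blast
    have su_eq: "simple_refl i \<circ> u = v \<longleftrightarrow> u = w" unfolding w by (metis simple_refl_comp_cancel(1))
    show ?case
    proof (cases "left_ascent i u")
      case True
      then have "perm_len (simple_refl i \<circ> u) = Suc (perm_len u)"
        by (rule perm_len_left_ascent[OF Cons.prems(2)])
      then have "perm_len v < perm_len (simple_refl i \<circ> u)" using Cons.prems(3) lw by linarith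
      then have "T_dual n v (simple_refl i \<circ> u) = 0" "u \<noteq> w"
        using IH[OF su] su_eq by auto
      then show ?thesis unfolding rec lmul_inv_def u0 using True by simp
    next
      case False
      then have "perm_len v \<le> perm_len (simple_refl i \<circ> u)"
        using perm_len_left_descent[OF Cons.prems(2) r(1)] Cons.prems(3) lw by linarith
      then have "T_dual n w u = q_inv * (if u = w then v_pow (- 2 * int (perm_len v)) else 0)"
        unfolding rec lmul_inv_def using False IH[OF su] unfolding su_eq by simp
      then show ?thesis using lw by (simp add: q_inv_def v_pow_mult)
    qed
  qed
qed

lemma at_q_pCons: "at_q (pCons a p) = of_int a + q_var * at_q p"
  by (simp add: at_q_def map_poly_pCons)

lemma lookup_at_q:
  "Poly_Mapping.lookup (at_q p) e = (if even e \<and> 0 \<le> e then coeff p (nat (e div 2)) else 0)"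
proof (induction p arbitrary: e)
  case 0
  then show ?case by (simp add: at_q_def)
next
  case (pCons a p)
  have "Poly_Mapping.lookup (of_int a :: laurent) e = (a when e = 0)"
    using lookup_single[of "0 :: int" a e] single_of_int[of a, where ?'b = int, where ?'a = int]
    by (auto simp: when_def)
  then have step: "Poly_Mapping.lookup (at_q (pCons a p)) e = (a when e = 0) +
      (if even (e - 2) \<and> 0 \<le> e - 2 then coeff p (nat ((e - 2) div 2)) else 0)"
    unfolding at_q_pCons lookup_add q_var_def lookup_v_pow_mult pCons.IH by simp
  show ?case
  proof (cases "even e \<and> 0 \<le> e")
    case True
    then obtain j where j: "e = 2 * j" "0 \<le> j" by (auto elim: evenE)
    show ?thesis
    proof (cases "nat j")
      case 0
      then show ?thesis unfolding step using j by simp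
    next
      case (Suc i)
      then have "j = int i + 1" using j by linarith
      then show ?thesis unfolding step using j by (simp add: nat_add_distrib coeff_pCons)
    qed
  next
    case False
    then show ?thesis unfolding step by (auto simp: when_def)
  qed
qed

text \<open>Look at the longest x where two families differ. By triangularity the coefficient of the
  difference there is fixed by a twisted bar involution, which is the symmetry
  \<open>e \<mapsto> 2 (l(w) - l(x)) - e\<close> of exponents; the degree bound puts all exponents strictly into the
  lower half.\<close>

lemma kl_family_unique:
  assumes P: "is_kl_family n w P" and P': "is_kl_family n w P'"
  shows "P = P'"
proof (rule ccontr)
  assume "P \<noteq> P'"
  define D where "D = {x. P x \<noteq> P' x}"
  have D: "bruhat_le n x w \<and> x \<noteq> w" if "x \<in> D" for x
  proof -
    have "P x = 0 \<and> P' x = 0" if "\<not> bruhat_le n x w" for x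
      using P P' that unfolding is_kl_family_def by blast
    moreover have "P w = P' w" using P P' unfolding is_kl_family_def by simp
    ultimately show ?thesis using that unfolding D_def by force
  qed
  then have "D \<subseteq> sym_grp n" by (auto simp: bruhat_le_def)
  then have fin: "finite D" by (rule finite_subset) simp
  have "D \<noteq> {}" using \<open>P \<noteq> P'\<close> by (auto simp: D_def fun_eq_iff)
  then have "Max (perm_len ` D) \<in> perm_len ` D" using fin by simp
  then obtain x where x: "x \<in> D" and xmax: "perm_len x = Max (perm_len ` D)" by auto
  have max: "perm_len y \<le> perm_len x" if "y \<in> D" for y
    using that fin unfolding xmax by simp
  have xS: "x \<in> sym_grp n" using x \<open>D \<subseteq> _\<close> by blast
  define N l where "N = int (perm_len w)" and "l = int (perm_len x)"
  define g where "g = at_q (P x) - at_q (P' x)"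
  define f f' where "f = kl_elt w P" and "f' = kl_elt w P'"
  have bars: "hecke_bar n f = f" "hecke_bar n f' = f'"
    using P P' by (simp_all add: is_kl_family_def f_def f'_def)
  have f_diff: "f x - f' x = v_pow (- N) * g"
    by (simp add: f_def f'_def kl_elt_def g_def N_def right_diff_distrib)
  have "f x - f' x = (\<Sum>y\<in>sym_grp n. laurent_bar (f y - f' y) * T_dual n y x)"
    by (subst bars(1)[symmetric], subst bars(2)[symmetric])
      (simp add: hecke_bar_def laurent_bar_diff left_diff_distrib sum_subtractf)
  also have "\<dots> = (\<Sum>y\<in>sym_grp n. if y = x then laurent_bar (f x - f' x) * v_pow (- 2 * l) else 0)"
  proof (rule sum.cong[OF refl])
    fix y assume y: "y \<in> sym_grp n"
    show "laurent_bar (f y - f' y) * T_dual n y x =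
        (if y = x then laurent_bar (f x - f' x) * v_pow (- 2 * l) else 0)"
    proof (cases "perm_len y \<le> perm_len x")
      case True
      then show ?thesis unfolding T_dual_triangular[OF y xS True] by (simp add: l_def)
    next
      case False
      then have "P y = P' y" using max unfolding D_def by blast
      then show ?thesis using False by (auto simp: f_def f'_def kl_elt_def)
    qed
  qed
  also have "\<dots> = laurent_bar (f x - f' x) * v_pow (- 2 * l)" using xS by simp
  finally have "v_pow (- N) * g = v_pow (- 2 * l) * (v_pow N * laurent_bar g)"
    unfolding f_diff laurent_bar_v_pow_mult by (simp add: mult.commute)
  then have lookups: "Poly_Mapping.lookup (v_pow (- N) * g) (e - N) =
      Poly_Mapping.lookup (v_pow (- 2 * l) * (v_pow N * laurent_bar g)) (e - N)" for e
    by simp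
  then have sym: "Poly_Mapping.lookup g e = Poly_Mapping.lookup g (2 * (N - l) - e)" for e
  proof -
    have "e - N - - N = e" "- (e - N - - 2 * l - N) = 2 * (N - l) - e" by simp_all
    then show ?thesis
      using lookups[of e] unfolding lookup_v_pow_mult lookup_laurent_bar by metis
  qed
  have g: "Poly_Mapping.lookup g (2 * int i) = coeff (P x) i - coeff (P' x) i" for i
    by (simp add: g_def lookup_minus lookup_at_q)
  have deg: "2 * degree (P x) + perm_len x + 1 \<le> perm_len w"
    "2 * degree (P' x) + perm_len x + 1 \<le> perm_len w"
    using D[OF x] P P' by (simp_all add: is_kl_family_def)
  have "coeff (P x) i = coeff (P' x) i" for i
  proof (cases "degree (P x) < i \<and> degree (P' x) < i")
    case True
    then show ?thesis by (simp add: coeff_eq_0)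
  next
    case False
    define j where "j = perm_len w - perm_len x - i"
    have "perm_len w = perm_len x + i + j" "degree (P x) < j" "degree (P' x) < j"
      using False deg unfolding j_def by linarith+
    then have j: "degree (P x) < j" "degree (P' x) < j" "2 * (N - l) - 2 * int i = 2 * int j"
      unfolding N_def l_def by simp_all
    have "coeff (P x) i - coeff (P' x) i = coeff (P x) j - coeff (P' x) j"
      using sym[of "2 * int i"] unfolding j(3) g .
    then show ?thesis using j by (simp add: coeff_eq_0)
  qed
  then show False using x by (simp add: D_def poly_eq_iff)
qed

lemma kl_poly_eqI:
  assumes "is_kl_family n w P"
  shows "kl_poly n x w = P x"
proof -
  have "(THE P. is_kl_family n w P) = P"
    using assms kl_family_unique by (intro the_equality)
  then show ?thesis by (simp add: kl_poly_def)
qed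

section \<open>A maximal parabolic subgroup and its longest element\<close>

text \<open>The longest element of the parabolic subgroup reverses \<open>{1..c}\<close> and \<open>{c+1..n}\<close> separately.\<close>

definition block_rev :: "nat \<Rightarrow> nat \<Rightarrow> perm" where
  "block_rev n c i = (if 1 \<le> i \<and> i \<le> c then c + 1 - i
     else if c < i \<and> i \<le> n then n + c + 1 - i else i)"

lemma involution_permutes:
  assumes "\<And>i. f (f i) = i" "\<And>i. i \<notin> S \<Longrightarrow> f i = i"
  shows "f permutes S"
  unfolding permutes_def using assms by metis

lemma block_rev_parab:
  assumes "c \<le> n"
  shows "block_rev n c \<in> parab n c"
proof -
  have inv: "block_rev n c (block_rev n c i) = i" for i using assms by (auto simp: block_rev_def)
  have "block_rev n c permutes {1..n}"
    by (rule involution_permutes[OF inv]) (use assms in \<open>auto simp: block_rev_def\<close>)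
  moreover have "block_rev n c ` {1..c} = {1..c}"
  proof -
    have sub: "block_rev n c ` {1..c} \<subseteq> {1..c}" by (auto simp: block_rev_def)
    then have "block_rev n c ` block_rev n c ` {1..c} \<subseteq> block_rev n c ` {1..c}" by (rule image_mono)
    then show ?thesis using sub by (simp add: image_image inv)
  qed
  ultimately show ?thesis by (simp add: parab_def sym_grp_def)
qed

text \<open>Without such an ascent u decreases on both blocks. Then u times the block reversal has no
  descent and is the identity.\<close>

lemma parab_ascent_exists:
  assumes u: "u \<in> parab n c" and c: "1 \<le> c" "c < n" and ne: "u \<noteq> block_rev n c"
  shows "\<exists>i\<in>{1..<n}. i \<noteq> c \<and> right_ascent i u"
proof (rule ccontr)
  assume "\<not> ?thesis"
  then have desc: "\<not> right_ascent i u" if "i \<in> {1..<n}" "i \<noteq> c" for i using that by blast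
  note uS = parab_sym_grp[OF u]
  have desc': "u (Suc i) < u i" if "i \<in> {1..<n}" "i \<noteq> c" for i
    using desc[OF that] sym_grp_eq_iff[OF uS, of i "Suc i"] by linarith
  define r where "r = block_rev n c"
  have r: "r \<in> parab n c" unfolding r_def by (rule block_rev_parab) (use c in simp)
  have "u \<circ> r = id"
  proof (rule no_descent_imp_id)
    show "u \<circ> r \<in> sym_grp n" by (rule parab_sym_grp[OF parab_comp[OF u r]])
    fix i assume i: "i \<in> {1..<n}"
    show "(u \<circ> r) i < (u \<circ> r) (Suc i)"
    proof (cases "i = c")
      case True
      show ?thesis unfolding True by (rule parab_ascent(3)[OF parab_comp[OF u r] c])
    next
      case False
      define j where "j = r (Suc i)"
      have "r i = Suc j" "j \<in> {1..<n}" "j \<noteq> c"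
        using i False c unfolding j_def r_def block_rev_def by auto
      then show ?thesis using desc'[of j] by (simp add: j_def)
    qed
  qed
  then have "u (r i) = i" for i by (simp add: fun_eq_iff)
  moreover have "r (r i) = i" for i using c by (auto simp: r_def block_rev_def)
  ultimately have "u i = r i" for i by metis
  then show False using ne unfolding r_def by (simp add: fun_eq_iff)
qed

text \<open>An element of maximal length admits no ascent inside the subgroup, so it is the block
  reversal.\<close>

lemma perm_len_less_block_rev:
  assumes u: "u \<in> parab n c" and c: "1 \<le> c" "c < n" and ne: "u \<noteq> block_rev n c"
  shows "perm_len u < perm_len (block_rev n c)"
proof -
  have step: "\<exists>v\<in>parab n c. perm_len u < perm_len v"
    if u: "u \<in> parab n c" "u \<noteq> block_rev n c" for u
  proof -
    obtain i where i: "i \<in> {1..<n}" "i \<noteq> c" "right_ascent i u"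
      using parab_ascent_exists[OF u(1) c u(2)] by blast
    have "perm_len (u \<circ> simple_refl i) = Suc (perm_len u)"
      by (rule perm_len_right_ascent[OF parab_sym_grp[OF u(1)] i(1,3)])
    then show ?thesis using parab_right_mult_iff[OF i(1,2)] u(1) by (metis lessI)
  qed
  have fin: "finite (parab n c)"
    by (rule finite_subset[of _ "sym_grp n"]) (auto simp: parab_sym_grp)
  define M where "M = Max (perm_len ` parab n c)"
  have le: "perm_len v \<le> M" if "v \<in> parab n c" for v using that fin by (simp add: M_def)
  have "M \<in> perm_len ` parab n c" unfolding M_def using fin u by (intro Max_in) auto
  then obtain v where v: "v \<in> parab n c" "perm_len v = M" by auto
  then have "v = block_rev n c" using step[OF v(1)] le by fastforce
  then show ?thesis using step[OF u ne] le v(2) by fastforce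
qed

lemma perm_len_le_block_rev:
  assumes "u \<in> parab n c" "1 \<le> c" "c < n"
  shows "perm_len u \<le> perm_len (block_rev n c)"
  using perm_len_less_block_rev[OF assms] by (cases "u = block_rev n c") auto

definition parab_sum :: "nat \<Rightarrow> nat \<Rightarrow> hecke_elt" where
  "parab_sum n c = (\<lambda>u. if u \<in> parab n c then 1 else 0)"

lemma T_dual_support:
  assumes w: "w \<in> parab n c" and c: "1 \<le> c" "c < n" and u: "u \<notin> parab n c"
  shows "T_dual n w u = 0"
proof -
  obtain ws where ws: "reduced_word n ws w" "c \<notin> set ws"
    using reduced_word_exists[OF w c(1)] c(2) by auto
  have "foldr lmul_inv ws (T_elt id) u = 0" if "set ws \<subseteq> {1..<n}" "c \<notin> set ws"
    using that u
  proof (induction ws arbitrary: u)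
    case Nil
    then have "u \<noteq> id" by auto
    then show ?case unfolding foldr.simps id_apply T_elt_def by (simp only: if_False)
  next
    case (Cons i ws)
    then have su: "simple_refl i \<circ> u \<notin> parab n c" using parab_left_mult_iff[of i n c u] by auto
    have ws: "set ws \<subseteq> {1..<n}" "c \<notin> set ws" using Cons.prems by simp_all
    have "lmul_inv i (foldr lmul_inv ws (T_elt id)) u = 0"
      unfolding lmul_inv_def Cons.IH[OF ws su] Cons.IH[OF ws Cons.prems(3)] by simp
    then show ?case by (simp only: foldr_Cons o_apply)
  qed
  then show ?thesis using ws unfolding T_dual_eq_lmul_inv_word[OF ws(1)] reduced_word_iff by blast
qed

text \<open>Up to scalars, the sum E over the parabolic subgroup is the only element supported there
  with \<open>T\<^sub>s E = q E\<close> for all its simple reflections s. The bar involution preserves the support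
  and turns the equation into \<open>T\<^sub>s\<inverse> E' = q\<inverse> E'\<close>, which is equivalent. So it maps E to a
  multiple of E; triangularity gives the factor at the longest element.\<close>

lemma hecke_bar_parab_sum:
  assumes c: "1 \<le> c" "c < n"
  shows "hecke_bar n (parab_sum n c) =
    (\<lambda>u. v_pow (- 2 * int (perm_len (block_rev n c))) * parab_sum n c u)"
proof -
  define g where "g = hecke_bar n (parab_sum n c)"
  define r where "r = block_rev n c"
  have r: "r \<in> parab n c" unfolding r_def by (rule block_rev_parab) (use c in simp)
  have inv: "g (simple_refl i \<circ> u) = g u" if i: "i \<in> {1..<n}" "i \<noteq> c" for i u
  proof -
    have "lmul i (parab_sum n c) = (\<lambda>u. v_pow 2 * parab_sum n c u)"
      unfolding lmul_def parab_sum_def parab_left_mult_iff[OF i]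
      by (simp add: fun_eq_iff q_var_def)
    then have "lmul_inv i g = (\<lambda>u. q_inv * g u)"
      using hecke_bar_lmul[OF i(1), of "parab_sum n c"]
      by (simp add: g_def hecke_bar_v_pow_mult q_inv_def)
    then have eq: "lmul_inv i g u = q_inv * g u" by simp
    show ?thesis
    proof (cases "left_ascent i u")
      case True
      then show ?thesis using eq by (simp add: lmul_inv_def left_diff_distrib del: o_apply)
    next
      case False
      then have "q_inv * g (simple_refl i \<circ> u) = q_inv * g u"
        using eq by (simp only: lmul_inv_def if_False)
      then have "q_var * (q_inv * g (simple_refl i \<circ> u)) = q_var * (q_inv * g u)"
        by (rule arg_cong)
      then show ?thesis by (simp only: q_inv_cancel)
    qed
  qed
  have "g (word_perm ws) = g id" if "set ws \<subseteq> {1..<n}" "c \<notin> set ws" for ws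
    using that
  proof (induction ws)
    case (Cons i ws)
    then have "g (word_perm (i # ws)) = g (word_perm ws)"
      unfolding word_perm.simps by (intro inv) auto
    also have "\<dots> = g id" by (rule Cons.IH) (use Cons.prems in auto)
    finally show ?case .
  qed simp
  then have const: "g u = g id" if "u \<in> parab n c" for u
    using reduced_word_exists[OF that c(1)] c(2) unfolding reduced_word_iff by fastforce
  have g_r: "g r = v_pow (- 2 * int (perm_len r))"
  proof -
    have "g r = (\<Sum>w\<in>sym_grp n. if w = r then v_pow (- 2 * int (perm_len r)) else 0)"
      unfolding g_def hecke_bar_def
    proof (rule sum.cong[OF refl])
      fix w assume w: "w \<in> sym_grp n"
      show "laurent_bar (parab_sum n c w) * T_dual n w r =
          (if w = r then v_pow (- 2 * int (perm_len r)) else 0)"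
      proof (cases "w \<in> parab n c")
        case True
        have "perm_len w \<le> perm_len r" unfolding r_def by (rule perm_len_le_block_rev[OF True c])
        from T_dual_triangular[OF w parab_sym_grp[OF r] this] True
        show ?thesis by (simp add: parab_sum_def)
      next
        case False
        then show ?thesis using r by (auto simp: parab_sum_def)
      qed
    qed
    then show ?thesis using parab_sym_grp[OF r] by simp
  qed
  have outside: "g u = 0" if "u \<notin> parab n c" for u
    unfolding g_def hecke_bar_def
    by (rule sum.neutral) (use T_dual_support[OF _ c that] in \<open>auto simp: parab_sum_def\<close>)
  show ?thesis
  proof
    fix u
    show "hecke_bar n (parab_sum n c) u =
        v_pow (- 2 * int (perm_len (block_rev n c))) * parab_sum n c u"
      using const[of u] const[OF r] g_r outside[of u]
      unfolding g_def[symmetric] r_def[symmetric] by (simp add: parab_sum_def)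
  qed
qed

section \<open>A Kazhdan--Lusztig element as a product\<close>

lemma commute_of_fixed:
  assumes "u \<in> sym_grp n" "u c = c" "u (Suc c) = Suc c"
  shows "simple_refl c \<circ> u = u \<circ> simple_refl c"
proof
  fix x
  show "(simple_refl c \<circ> u) x = (u \<circ> simple_refl c) x"
    using assms(2,3) sym_grp_eq_iff[OF assms(1), of x c] sym_grp_eq_iff[OF assms(1), of x "Suc c"]
    by (simp add: simple_refl_apply)
qed

text \<open>An element u of the parabolic subgroup, like its inverse, maps c to at most c and \<open>c + 1\<close> to
  at least \<open>c + 1\<close>. Exchanging c and \<open>c + 1\<close> keeps the images in order unless both are fixed.\<close>

lemma parab_coset_ascent:
  assumes u: "u \<in> parab n c" and c: "1 \<le> c" "c < n"
  shows "\<not> (u c = c \<and> u (Suc c) = Suc c) \<Longrightarrow> left_ascent c (u \<circ> simple_refl c)"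
    and "\<not> (u c = c \<and> u (Suc c) = Suc c) \<Longrightarrow> right_ascent c (simple_refl c \<circ> u)"
proof -
  note uS = parab_sym_grp[OF u]
  assume ne: "\<not> (u c = c \<and> u (Suc c) = Suc c)"
  have "\<not> (inv u c = c \<and> inv u (Suc c) = Suc c)" using ne sym_grp_inv_apply(2)[OF uS] by metis
  then show "left_ascent c (u \<circ> simple_refl c)"
    using parab_ascent[OF parab_inv[OF u] c]
    by (auto simp: inv_simple_refl_comp(2)[OF sym_grp_bij[OF uS]] simple_refl_apply)
  show "right_ascent c (simple_refl c \<circ> u)"
    using ne parab_ascent[OF u c] by (auto simp: simple_refl_apply)
qed

lemma perm_len_double_coset:
  assumes u: "u \<in> parab n c" and c: "1 \<le> c" "c < n"
    and ne: "\<not> (u c = c \<and> u (Suc c) = Suc c)"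
  shows "perm_len (simple_refl c \<circ> (u \<circ> simple_refl c)) = perm_len u + 2"
proof -
  have cn: "c \<in> {1..<n}" using c by simp
  note uS = parab_sym_grp[OF u]
  have "perm_len (simple_refl c \<circ> (u \<circ> simple_refl c)) = Suc (perm_len (u \<circ> simple_refl c))"
    by (rule perm_len_left_ascent[OF _ parab_coset_ascent(1)[OF u c ne]])
      (use uS right_mult_sym_grp_iff[OF cn] in blast)
  then show ?thesis
    using perm_len_right_ascent[OF uS cn parab_ascent(3)[OF u c]] by linarith
qed

lemma parab_mult_notin:
  assumes u: "u \<in> parab n c" and c: "1 \<le> c" "c < n"
  shows "u \<circ> simple_refl c \<notin> parab n c" "simple_refl c \<circ> u \<notin> parab n c"
proof -
  note uS = parab_sym_grp[OF u]
  show "u \<circ> simple_refl c \<notin> parab n c"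
    using parab_ascent(3)[OF u c] parab_ascent(3)[OF _ c, of "u \<circ> simple_refl c"]
      right_ascent_flip[OF uS, of c] by blast
  show "simple_refl c \<circ> u \<notin> parab n c"
    using parab_ascent(3)[OF parab_inv[OF u] c]
      parab_ascent(3)[OF parab_inv c, of "simple_refl c \<circ> u"] left_ascent_flip[OF uS, of c] by blast
qed

text \<open>If u and \<open>sus\<close> both lay in the parabolic subgroup and u did not commute with s, then passing
  from u to \<open>sus\<close> and back would add four to the length.\<close>

lemma parab_conj_imp_fixed:
  assumes u: "u \<in> parab n c" and v: "simple_refl c \<circ> (u \<circ> simple_refl c) \<in> parab n c"
    and c: "1 \<le> c" "c < n"
  shows "u c = c \<and> u (Suc c) = Suc c"
proof (rule ccontr)
  assume ne: "\<not> ?thesis"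
  define v where "v = simple_refl c \<circ> (u \<circ> simple_refl c)"
  have v: "v \<in> parab n c" using assms(2) by (simp only: v_def)
  have vu: "simple_refl c \<circ> (v \<circ> simple_refl c) = u" by (simp add: v_def fun_eq_iff)
  show False
  proof (cases "v c = c \<and> v (Suc c) = Suc c")
    case True
    then show False using ne unfolding vu[symmetric] by (simp add: simple_refl_apply)
  next
    case False
    then show False
      using perm_len_double_coset[OF v c False] perm_len_double_coset[OF u c ne]
      unfolding vu unfolding v_def[symmetric] by linarith
  qed
qed

text \<open>With E the sum over the parabolic subgroup and s the c-th simple reflection,
  \<open>half_support\<close> is the support of \<open>E (1 + T\<^sub>s)\<close> and \<open>product_support\<close> that of
  \<open>(1 + T\<^sub>s) E (1 + T\<^sub>s)\<close>. On \<open>double_support\<close> both terms of the left factor contribute.\<close>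

definition half_support :: "nat \<Rightarrow> nat \<Rightarrow> perm set" where
  "half_support n c = {y. y \<in> parab n c \<or> y \<circ> simple_refl c \<in> parab n c}"

definition product_support :: "nat \<Rightarrow> nat \<Rightarrow> perm set" where
  "product_support n c = {y. y \<in> half_support n c \<or> simple_refl c \<circ> y \<in> half_support n c}"

definition conj_block_rev :: "nat \<Rightarrow> nat \<Rightarrow> perm" where
  "conj_block_rev n c = simple_refl c \<circ> (block_rev n c \<circ> simple_refl c)"

definition double_support :: "nat \<Rightarrow> nat \<Rightarrow> perm set" where
  "double_support n c = {y \<in> half_support n c. simple_refl c \<circ> y \<in> half_support n c}"

definition kl_coeff :: "nat \<Rightarrow> nat \<Rightarrow> perm \<Rightarrow> int poly" where
  "kl_coeff n c y = (if y \<in> double_support n c then [:1, 1:] else if y \<in> product_support n c then 1 else 0)"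

lemma half_support_sym_grp:
  assumes "y \<in> half_support n c" "1 \<le> c" "c < n"
  shows "y \<in> sym_grp n"
  using assms right_mult_sym_grp_iff[of c n y] parab_sym_grp by (auto simp: half_support_def)

lemma product_support_sym_grp:
  assumes "y \<in> product_support n c" "1 \<le> c" "c < n"
  shows "y \<in> sym_grp n"
  using assms left_mult_sym_grp_iff[of c n y] half_support_sym_grp by (auto simp: product_support_def)

text \<open>Where left multiplication by s shortens, \<open>half_support\<close> is stable under it. This prevents
  factors q in the coefficients of \<open>(1 + T\<^sub>s) E (1 + T\<^sub>s)\<close> outside \<open>double_support\<close>.\<close>

lemma half_support_descent:
  assumes y: "y \<in> half_support n c" and c: "1 \<le> c" "c < n" and desc: "\<not> left_ascent c y"
  shows "simple_refl c \<circ> y \<in> half_support n c"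
proof -
  have ny: "y \<notin> parab n c" using desc parab_ascent(3)[OF parab_inv c, of y] by blast
  define u where "u = y \<circ> simple_refl c"
  have u: "u \<in> parab n c" using y ny by (auto simp: half_support_def u_def)
  have yu: "y = u \<circ> simple_refl c" by (simp add: u_def)
  have "u c = c \<and> u (Suc c) = Suc c"
    using parab_coset_ascent(1)[OF u c] desc unfolding yu by blast
  then have "simple_refl c \<circ> u = u \<circ> simple_refl c"
    using commute_of_fixed[OF parab_sym_grp[OF u]] by blast
  then have "simple_refl c \<circ> y = u" unfolding yu by (metis simple_refl_comp_cancel(1))
  then show ?thesis using u by (simp add: half_support_def)
qed

lemma right_product_coeff:
  assumes c: "1 \<le> c" "c < n"
  shows "parab_sum n c y + rmul c (parab_sum n c) y = (if y \<in> half_support n c then 1 else 0)"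
proof -
  have "right_ascent c y" if "y \<in> parab n c" using parab_ascent(3)[OF that c] .
  moreover have "\<not> right_ascent c y" if "y \<circ> simple_refl c \<in> parab n c"
    using parab_ascent(3)[OF that c] by (auto simp: simple_refl_apply)
  ultimately show ?thesis
    by (auto simp: rmul_def parab_sum_def half_support_def simp del: o_apply)
qed

lemma left_product_coeff:
  assumes c: "1 \<le> c" "c < n" and F: "F = (\<lambda>y. if y \<in> half_support n c then 1 else 0)"
  shows "F y + lmul c F y = at_q (kl_coeff n c y)"
proof -
  have at_q: "at_q [:1, 1:] = 1 + q_var" "at_q 1 = 1" "at_q 0 = 0"
    by (simp_all add: at_q_def map_poly_pCons flip: one_pCons)
  have 1: "left_ascent c y" if "y \<in> half_support n c" "simple_refl c \<circ> y \<notin> half_support n c"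
    using half_support_descent[OF that(1) c] that(2) by blast
  have 2: "\<not> left_ascent c y" if "y \<notin> half_support n c" "simple_refl c \<circ> y \<in> half_support n c"
  proof -
    have "left_ascent c (simple_refl c \<circ> y)"
      using half_support_descent[OF that(2) c] that(1) unfolding simple_refl_comp_cancel by blast
    moreover have "y \<in> sym_grp n"
      using half_support_sym_grp[OF that(2) c] left_mult_sym_grp_iff[of c n y] c by simp
    ultimately show ?thesis using left_ascent_flip[of y n c] by blast
  qed
  have q: "y \<in> half_support n c \<Longrightarrow> simple_refl c \<circ> y \<in> half_support n c \<Longrightarrow>
      F y + lmul c F y = 1 + q_var"
    unfolding F lmul_def by (auto simp del: o_apply)
  show ?thesis
    using 1 2 q unfolding kl_coeff_def double_support_def product_support_def mem_Collect_eq
    by (auto simp: at_q F lmul_def simp del: o_apply)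
qed

text \<open>Since \<open>1 + T\<^sub>s\<inverse> = q\<inverse> (1 + T\<^sub>s)\<close>, multiplication by \<open>1 + T\<^sub>s\<close> preserves invariance under the
  bar involution up to a power of q.\<close>

lemma hecke_bar_one_plus_generator:
  assumes i: "i \<in> {1..<n}" and h: "hecke_bar n h = (\<lambda>u. v_pow k * h u)"
  shows "hecke_bar n (\<lambda>u. h u + lmul i h u) = (\<lambda>u. v_pow (k - 2) * (h u + lmul i h u))"
    and "hecke_bar n (\<lambda>u. h u + rmul i h u) = (\<lambda>u. v_pow (k - 2) * (h u + rmul i h u))"
proof -
  have k: "v_pow (k - 2) * a = v_pow k * (q_inv * a)" for a
    by (simp add: q_inv_def v_pow_mult flip: mult.assoc)
  have "lmul_inv i (\<lambda>u. v_pow k * h u) u = v_pow k * (q_inv * lmul i h u + (q_inv - 1) * h u)"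
    "rmul_inv i (\<lambda>u. v_pow k * h u) u = v_pow k * (q_inv * rmul i h u + (q_inv - 1) * h u)" for u
    by (simp_all add: lmul_inv_def lmul_def rmul_inv_def rmul_def algebra_simps del: o_apply)
  then show "hecke_bar n (\<lambda>u. h u + lmul i h u) = (\<lambda>u. v_pow (k - 2) * (h u + lmul i h u))"
    "hecke_bar n (\<lambda>u. h u + rmul i h u) = (\<lambda>u. v_pow (k - 2) * (h u + rmul i h u))"
    unfolding hecke_bar_add hecke_bar_lmul[OF i] hecke_bar_rmul[OF i] h k
    by (simp_all add: algebra_simps)
qed

lemma hecke_bar_kl_coeff:
  assumes c: "1 \<le> c" "c < n"
  shows "hecke_bar n (\<lambda>y. at_q (kl_coeff n c y)) =
    (\<lambda>y. v_pow (- 2 * int (perm_len (block_rev n c) + 2)) * at_q (kl_coeff n c y))"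
proof -
  have cn: "c \<in> {1..<n}" using c by simp
  define F :: hecke_elt where "F = (\<lambda>y. if y \<in> half_support n c then 1 else 0)"
  define k where "k = - 2 * int (perm_len (block_rev n c))"
  have F: "parab_sum n c y + rmul c (parab_sum n c) y = F y" for y
    unfolding right_product_coeff[OF c] F_def ..
  have "hecke_bar n F = (\<lambda>y. v_pow (k - 2) * F y)"
    using hecke_bar_one_plus_generator(2)[OF cn hecke_bar_parab_sum[OF c]] unfolding F k_def .
  from hecke_bar_one_plus_generator(1)[OF cn this]
  have "hecke_bar n (\<lambda>y. at_q (kl_coeff n c y)) = (\<lambda>y. v_pow (k - 2 - 2) * at_q (kl_coeff n c y))"
    unfolding left_product_coeff[OF c F_def] .
  moreover have "k - 2 - 2 = - 2 * int (perm_len (block_rev n c) + 2)" unfolding k_def by simp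
  ultimately show ?thesis by (simp only:)
qed

section \<open>Bounding the support in Bruhat order\<close>

lemma bruhat_step_left:
  assumes "y \<in> sym_grp n" "c \<in> {1..<n}" "left_ascent c y"
  shows "bruhat_step n y (simple_refl c \<circ> y)"
proof -
  have "1 \<le> inv y c" "inv y (Suc c) \<le> n"
    using sym_grp_range[OF sym_grp_inv[OF assms(1)], of c]
      sym_grp_range[OF sym_grp_inv[OF assms(1)], of "Suc c"] assms(2) by auto
  then show ?thesis
    unfolding bruhat_step_def
    using assms perm_len_left_ascent[OF assms(1,3)]
      transpose_comp_eq[OF sym_grp_bij[OF assms(1)], of c "Suc c"]
    by (intro exI[of _ "inv y c"] exI[of _ "inv y (Suc c)"]) (simp add: simple_refl_def)
qed

lemma bruhat_step_right:
  assumes "y \<in> sym_grp n" "c \<in> {1..<n}" "right_ascent c y"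
  shows "bruhat_step n y (y \<circ> simple_refl c)"
  unfolding bruhat_step_def
  using assms perm_len_right_ascent[OF assms]
  by (intro exI[of _ c] exI[of _ "Suc c"]) (simp add: simple_refl_def)

lemma parab_fixed_ascent:
  assumes u: "u \<in> parab n c" and fixed: "u c = c" "u (Suc c) = Suc c" and c: "2 \<le> c" "c + 2 \<le> n"
  shows "u (c - 1) < c" "Suc c < u (Suc (Suc c))"
proof -
  note inj = sym_grp_eq_iff[OF parab_sym_grp[OF u]]
  have "1 \<le> c - 1 \<and> c - 1 \<le> c" "c - 1 \<noteq> c" using c by linarith+
  then have "u (c - 1) \<le> c" "u (c - 1) \<noteq> u c" using parab_block[OF u, of "c - 1"] inj by blast+
  then show "u (c - 1) < c" using fixed by simp
  have "c < u (Suc (Suc c))"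
    using parab_block[OF u, of "Suc (Suc c)"] sym_grp_range[OF parab_sym_grp[OF u], of "Suc (Suc c)"]
      c by auto
  moreover have "u (Suc (Suc c)) \<noteq> u (Suc c)" using inj by simp
  ultimately show "Suc c < u (Suc (Suc c))" using fixed by simp
qed

text \<open>A permutation in the support has the form u, us, su or sus with u in the parabolic subgroup.
  The first three can be multiplied by s on a further side, or by the generator with index
  \<open>c - 1\<close> if u commutes with s. A permutation sus of none of the first three forms is lengthened
  by lengthening u inside the subgroup, which is possible until u is the block reversal.\<close>

lemma product_support_step_up:
  assumes y: "y \<in> product_support n c" and c: "2 \<le> c" "c + 2 \<le> n" and ne: "y \<noteq> conj_block_rev n c"
  shows "\<exists>z\<in>product_support n c. bruhat_step n y z"
proof -
  define s where "s = simple_refl c"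
  define t where "t = simple_refl (c - 1)"
  have c': "1 \<le> c" "c < n" and cn: "c \<in> {1..<n}" and c1: "c - 1 \<in> {1..<n}" "c - 1 \<noteq> c"
    using c by auto
  have yS: "y \<in> sym_grp n" by (rule product_support_sym_grp[OF y c'])
  have ss: "s \<circ> (s \<circ> z) = z" "z \<circ> s \<circ> s = z" for z by (simp_all add: s_def)
  have right_coset: "\<exists>z\<in>product_support n c. bruhat_step n y z"
    if u: "u \<in> parab n c" and yu: "y = u \<circ> s" for u
  proof (cases "left_ascent c y")
    case True
    have "y \<in> half_support n c" using u unfolding half_support_def mem_Collect_eq yu ss s_def[symmetric] by blast
    then have "s \<circ> y \<in> product_support n c" unfolding product_support_def mem_Collect_eq s_def[symmetric] ss by blast
    then show ?thesis using bruhat_step_left[OF yS cn True] unfolding s_def by blast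
  next
    case False
    then have fixed: "u c = c" "u (Suc c) = Suc c"
      using parab_coset_ascent(1)[OF u c'] unfolding yu s_def by blast+
    have "right_ascent (c - 1) y"
    proof -
      have "Suc (c - 1) = c" "c - 1 \<noteq> c" "c - 1 \<noteq> Suc c" using c by linarith+
      then show ?thesis
        using parab_fixed_ascent(1)[OF u fixed c] fixed unfolding yu s_def
        by (simp add: simple_refl_apply)
    qed
    note step = bruhat_step_right[OF yS c1(1) this]
    have "s \<circ> (y \<circ> t) = s \<circ> (s \<circ> u) \<circ> t"
      unfolding yu using commute_of_fixed[OF parab_sym_grp[OF u] fixed] by (simp only: o_assoc s_def)
    also have "\<dots> = u \<circ> t" unfolding ss ..
    finally have "s \<circ> (y \<circ> t) \<in> parab n c"
      using parab_right_mult_iff[OF c1] u unfolding t_def by simp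
    then have "y \<circ> t \<in> product_support n c"
      unfolding product_support_def half_support_def mem_Collect_eq s_def[symmetric] by blast
    then show ?thesis using step unfolding t_def by blast
  qed
  show ?thesis
  proof (cases "y \<in> half_support n c")
    case True
    show ?thesis
    proof (cases "y \<in> parab n c")
      case True
      have "y \<circ> s \<in> product_support n c"
        unfolding product_support_def half_support_def mem_Collect_eq s_def[symmetric] ss using True by blast
      then show ?thesis
        using bruhat_step_right[OF yS cn parab_ascent(3)[OF True c']] unfolding s_def by blast
    next
      case False
      then have "y \<circ> s \<in> parab n c" using True by (simp add: half_support_def s_def)
      then show ?thesis by (rule right_coset) (simp only: ss)
    qed
  next
    case False
    then have z: "s \<circ> y \<in> half_support n c" using y by (simp add: product_support_def s_def)
    have noncomm: "\<not> (u c = c \<and> u (Suc c) = Suc c)"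
      if u: "u \<in> parab n c" "y = s \<circ> u \<or> y = s \<circ> (u \<circ> s)" for u
    proof
      assume "u c = c \<and> u (Suc c) = Suc c"
      then have comm: "s \<circ> u = u \<circ> s" using commute_of_fixed[OF parab_sym_grp[OF u(1)]] s_def by blast
      then have "s \<circ> (u \<circ> s) = u" by (metis ss(1))
      then have "y \<in> half_support n c"
        using u comm unfolding half_support_def mem_Collect_eq s_def[symmetric] by (metis ss(2))
      then show False using False by blast
    qed
    show ?thesis
    proof (cases "s \<circ> y \<in> parab n c")
      case True
      have "y = s \<circ> (s \<circ> y)" by (simp only: ss)
      from parab_coset_ascent(2)[OF True c' noncomm[OF True disjI1[OF this]]]
      have "right_ascent c y" unfolding s_def simple_refl_comp_cancel .
      note step = bruhat_step_right[OF yS cn this]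
      have "s \<circ> (y \<circ> s) \<circ> s = s \<circ> y" using ss(2)[of "s \<circ> y"] by (simp only: o_assoc)
      then have "y \<circ> s \<in> product_support n c"
        using True unfolding product_support_def half_support_def mem_Collect_eq s_def[symmetric] by simp
      then show ?thesis using step unfolding s_def by blast
    next
      case False
      define u where "u = s \<circ> y \<circ> s"
      have u: "u \<in> parab n c" using False z by (simp add: half_support_def u_def s_def)
      have yu: "y = s \<circ> (u \<circ> s)" unfolding u_def ss ..
      have ncu: "\<not> (u c = c \<and> u (Suc c) = Suc c)" by (rule noncomm[OF u disjI2[OF yu]])
      have "u \<noteq> block_rev n c" using ne yu unfolding conj_block_rev_def s_def by blast
      then obtain i where i: "i \<in> {1..<n}" "i \<noteq> c" "right_ascent i u"
        using parab_ascent_exists[OF u c'] by blast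
      define u' where "u' = u \<circ> simple_refl i"
      have u': "u' \<in> parab n c" using parab_right_mult_iff[OF i(1,2)] u unfolding u'_def by blast
      have uu': "u = u' \<circ> simple_refl i" unfolding u'_def by simp
      have len: "perm_len u' = Suc (perm_len u)"
        unfolding u'_def by (rule perm_len_right_ascent[OF parab_sym_grp[OF u] i(1,3)])
      have ncu': "\<not> (u' c = c \<and> u' (Suc c) = Suc c)"
      proof
        assume fixed: "u' c = c \<and> u' (Suc c) = Suc c"
        then have "u' (c - 1) < c" "Suc c < u' (Suc (Suc c))"
          using parab_fixed_ascent[OF u' _ _ c] by blast+
        \<comment> \<open>The letter i moves c or c + 1, as u does not fix both; then i is a descent of u.\<close>
        moreover have "Suc i = c \<or> i = Suc c"
          using ncu fixed i(2) unfolding uu' by (auto simp: simple_refl_apply split: if_splits)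
        ultimately show False
          using i(3) fixed unfolding uu' o_apply by (auto simp: simple_refl_apply)
      qed
      define a b where "a = s i" and "b = s (Suc i)"
      have ab: "1 \<le> a" "a < b" "b \<le> n" using i c' unfolding a_def b_def s_def
        by (auto simp: simple_refl_apply)
      have "simple_refl i \<circ> s = s \<circ> transpose a b"
        using transpose_comp_eq[OF bij_simple_refl[of c], of i "Suc i"]
        by (simp only: simple_refl_def[of i] inv_simple_refl a_def b_def s_def)
      then have conj: "s \<circ> (u' \<circ> s) = y \<circ> transpose a b"
        unfolding yu u'_def by (simp only: comp_assoc)
      have "perm_len y < perm_len (s \<circ> (u' \<circ> s))"
        using perm_len_double_coset[OF u' c' ncu'] perm_len_double_coset[OF u c' ncu] len
        unfolding yu s_def by simp
      then have step: "bruhat_step n y (s \<circ> (u' \<circ> s))"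
        unfolding bruhat_step_def conj using ab by blast
      have "s \<circ> (u' \<circ> s) \<in> product_support n c"
        unfolding product_support_def half_support_def mem_Collect_eq s_def[symmetric] ss using u' by blast
      then show ?thesis using step by blast
    qed
  qed
qed

lemma conj_block_rev_sym_grp:
  assumes "1 \<le> c" "c < n"
  shows "conj_block_rev n c \<in> sym_grp n"
  unfolding conj_block_rev_def
  using assms left_mult_sym_grp_iff[of c n] right_mult_sym_grp_iff[of c n]
    parab_sym_grp[OF block_rev_parab[of c n]] by simp

lemma bruhat_le_refl: "w \<in> sym_grp n \<Longrightarrow> bruhat_le n w w"
  by (simp add: bruhat_le_def)

lemma bruhat_le_step:
  assumes "u \<in> sym_grp n" "bruhat_step n u v" "bruhat_le n v w"
  shows "bruhat_le n u w"
  using assms unfolding bruhat_le_def by (meson converse_rtranclp_into_rtranclp)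

text \<open>Since lengths on the finite group are bounded, steps upwards inside the support end, and they
  can only end at the one element without such a step.\<close>

lemma product_support_bruhat_le:
  assumes y: "y \<in> product_support n c" and c: "2 \<le> c" "c + 2 \<le> n"
  shows "bruhat_le n y (conj_block_rev n c)"
proof -
  have c': "1 \<le> c" "c < n" using c by simp_all
  define M where "M = Max (perm_len ` sym_grp n)"
  show ?thesis
    using y
  proof (induction "M - perm_len y" arbitrary: y rule: less_induct)
    case less
    show ?case
    proof (cases "y = conj_block_rev n c")
      case True
      then show ?thesis using bruhat_le_refl[OF conj_block_rev_sym_grp[OF c']] by simp
    next
      case False
      then obtain z where z: "z \<in> product_support n c" "bruhat_step n y z"
        using product_support_step_up[OF less.prems c] by blast
      have "perm_len y < perm_len z" using z(2) unfolding bruhat_step_def by blast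
      moreover have "perm_len z \<le> M"
        unfolding M_def using product_support_sym_grp[OF z(1) c'] by (intro Max_ge) auto
      ultimately have "M - perm_len z < M - perm_len y" by linarith
      then have "bruhat_le n z (conj_block_rev n c)" using less.hyps z(1) by blast
      then show ?thesis by (rule bruhat_le_step[OF product_support_sym_grp[OF less.prems c'] z(2)])
    qed
  qed
qed

lemma bruhat_le_perm_len:
  assumes "bruhat_le n u w" "u \<noteq> w"
  shows "perm_len u < perm_len w"
proof -
  have "(bruhat_step n)\<^sup>*\<^sup>* u w" using assms(1) by (simp add: bruhat_le_def)
  then have "u = w \<or> perm_len u < perm_len w"
    by (induction rule: rtranclp_induct) (auto simp: bruhat_step_def)
  then show ?thesis using assms(2) by blast
qed

lemma perm_len_conj_block_rev:
  assumes "2 \<le> c" "c < n"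
  shows "perm_len (conj_block_rev n c) = perm_len (block_rev n c) + 2"
  unfolding conj_block_rev_def
  by (rule perm_len_double_coset[OF block_rev_parab]) (use assms in \<open>auto simp: block_rev_def\<close>)

text \<open>On the double support the polynomial has degree one. Such a permutation is u or us with u in
  the parabolic subgroup fixing c and c + 1; the generators with indices c - 1 and c + 1 both
  lengthen u, so u has at least two inversions fewer than the longest element.\<close>

lemma perm_len_double_support:
  assumes y: "y \<in> double_support n c" and c: "2 \<le> c" "c + 2 \<le> n"
  shows "perm_len y + 3 \<le> perm_len (conj_block_rev n c)"
proof -
  define s where "s = simple_refl c"
  have ss: "s \<circ> (s \<circ> z) = z" "z \<circ> s \<circ> s = z" for z by (simp_all add: s_def)
  have c': "1 \<le> c" "c < n" and cn: "c \<in> {1..<n}" using c by auto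
  obtain u where u: "u \<in> parab n c" and yu: "y = u \<or> y = u \<circ> s"
    using y unfolding double_support_def half_support_def mem_Collect_eq s_def[symmetric]
    by (metis ss(2))
  have sy: "s \<circ> y \<in> parab n c \<or> s \<circ> y \<circ> s \<in> parab n c"
    using y unfolding double_support_def half_support_def mem_Collect_eq s_def[symmetric] by blast
  have no: "s \<circ> u \<notin> parab n c" unfolding s_def by (rule parab_mult_notin(2)[OF u c'])
  have "s \<circ> (u \<circ> s) \<in> parab n c"
    using yu
  proof
    assume "y = u"
    then show ?thesis using sy no by (simp only: o_assoc) blast
  next
    assume "y = u \<circ> s"
    moreover have "s \<circ> (u \<circ> s) \<circ> s = s \<circ> u" using ss(2)[of "s \<circ> u"] by (simp only: o_assoc)
    ultimately show ?thesis using sy no by metis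
  qed
  then have fixed: "u c = c" "u (Suc c) = Suc c"
    using parab_conj_imp_fixed[OF u _ c'] unfolding s_def by blast+
  note asc = parab_fixed_ascent[OF u fixed c]
  define v where "v = u \<circ> simple_refl (c - 1)"
  have i: "c - 1 \<in> {1..<n}" "c - 1 \<noteq> c" "Suc (c - 1) = c" and j: "Suc c \<in> {1..<n}" "Suc c \<noteq> c"
    using c by auto
  have v: "v \<in> parab n c" using parab_right_mult_iff[OF i(1,2)] u unfolding v_def by blast
  have "right_ascent (c - 1) u" unfolding i(3) fixed by (rule asc(1))
  then have lv: "perm_len v = Suc (perm_len u)"
    unfolding v_def by (rule perm_len_right_ascent[OF parab_sym_grp[OF u] i(1)])
  have "v (Suc c) = Suc c" "v (Suc (Suc c)) = u (Suc (Suc c))"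
    using i(3) fixed unfolding v_def by (simp_all add: simple_refl_apply)
  then have "right_ascent (Suc c) v" using asc(2) by simp
  from perm_len_right_ascent[OF parab_sym_grp[OF v] j(1) this]
  have lw: "perm_len (v \<circ> simple_refl (Suc c)) = Suc (perm_len v)" .
  have "perm_len (v \<circ> simple_refl (Suc c)) \<le> perm_len (block_rev n c)"
    using parab_right_mult_iff[OF j] v by (intro perm_len_le_block_rev[OF _ c']) blast
  moreover have "perm_len y \<le> Suc (perm_len u)"
    using yu perm_len_right_ascent[OF parab_sym_grp[OF u] cn parab_ascent(3)[OF u c']]
    unfolding s_def by auto
  ultimately show ?thesis using lv lw perm_len_conj_block_rev[OF c(1) c'(2)] by linarith
qed

lemma conj_block_rev_not_half_support:
  assumes c: "2 \<le> c" "c < n"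
  shows "conj_block_rev n c \<notin> half_support n c"
proof -
  have "conj_block_rev n c 1 = Suc c" "(conj_block_rev n c \<circ> simple_refl c) 1 = Suc c"
    using c by (simp_all add: conj_block_rev_def simple_refl_apply block_rev_def)
  then have "\<not> conj_block_rev n c 1 \<le> c" "\<not> (conj_block_rev n c \<circ> simple_refl c) 1 \<le> c" by linarith+
  then show ?thesis
    unfolding half_support_def mem_Collect_eq using parab_block[of _ n c 1] c(1)
    by (metis One_nat_def Suc_leD le_refl numeral_2_eq_2)
qed

lemma is_kl_family_kl_coeff:
  assumes c: "2 \<le> c" "c + 2 \<le> n"
  shows "is_kl_family n (conj_block_rev n c) (kl_coeff n c)"
proof -
  have c': "1 \<le> c" "c < n" using c by simp_all
  have sub: "double_support n c \<subseteq> product_support n c"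
    by (auto simp: double_support_def product_support_def)
  have 1: "kl_coeff n c y = 0" if "\<not> bruhat_le n y (conj_block_rev n c)" for y
    using that product_support_bruhat_le[OF _ c] sub unfolding kl_coeff_def by auto
  have 2: "kl_coeff n c (conj_block_rev n c) = 1"
  proof -
    have "simple_refl c \<circ> conj_block_rev n c = block_rev n c \<circ> simple_refl c"
      unfolding conj_block_rev_def simple_refl_comp_cancel ..
    then have "simple_refl c \<circ> conj_block_rev n c \<in> half_support n c"
      unfolding half_support_def mem_Collect_eq simple_refl_comp_cancel
      using block_rev_parab[of c n] c' by (metis less_imp_le simple_refl_comp_cancel(2))
    then show ?thesis
      using conj_block_rev_not_half_support[OF c(1) c'(2)]
      unfolding kl_coeff_def double_support_def product_support_def mem_Collect_eq by simp
  qed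
  have 3: "2 * degree (kl_coeff n c y) + perm_len y + 1 \<le> perm_len (conj_block_rev n c)"
    if y: "bruhat_le n y (conj_block_rev n c)" "y \<noteq> conj_block_rev n c" for y
  proof (cases "y \<in> double_support n c")
    case True
    then show ?thesis using perm_len_double_support[OF True c] by (simp add: kl_coeff_def)
  next
    case False
    then have "degree (kl_coeff n c y) = 0" by (simp add: kl_coeff_def)
    then show ?thesis using bruhat_le_perm_len[OF y] by simp
  qed
  have 4: "hecke_bar n (kl_elt (conj_block_rev n c) (kl_coeff n c)) = kl_elt (conj_block_rev n c) (kl_coeff n c)"
    unfolding kl_elt_def hecke_bar_v_pow_mult hecke_bar_kl_coeff[OF c']
      perm_len_conj_block_rev[OF c(1) c'(2)]
    by (simp add: v_pow_mult flip: mult.assoc)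
  show ?thesis
    unfolding is_kl_family_def using 1 2 3 4 by blast
qed

section \<open>The permutations in one-line notation\<close>

lemma length_down [simp]: "length (down a b) = Suc a - b"
  by (simp add: down_def del: upt_Suc)

lemma nth_down [simp]: "j < Suc a - b \<Longrightarrow> down a b ! j = a - j"
  by (simp add: down_def rev_nth del: upt_Suc)

lemma w_perm_eq_conj_block_rev:
  assumes "k \<ge> 1" "m \<ge> 1"
  shows "w_perm k m = conj_block_rev (k + 2 + m) (k + 1)"
proof
  fix i
  consider "i = 0" | "i = 1" | "2 \<le> i" "i \<le> k" | "i = k + 1" | "i = k + 2"
    | "k + 3 \<le> i" "i \<le> k + m + 1" | "i = k + m + 2" | "k + m + 2 < i"
    using assms by linarith
  then show "w_perm k m i = conj_block_rev (k + 2 + m) (k + 1) i"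
    using assms
    by cases (auto simp: w_perm_def one_line_def conj_block_rev_def simple_refl_apply block_rev_def
        nth_append nth_Cons')
qed

text \<open>The permutation is su, where u reverses the first k and the last m letters and fixes the two
  letters in between. Hence u commutes with s, and both su and u lie in \<open>half_support\<close>.\<close>

lemma x_perm_double_support:
  assumes "k \<ge> 1" "m \<ge> 1"
  shows "x_perm k m \<in> double_support (k + 2 + m) (k + 1)"
proof -
  define n c where "n = k + 2 + m" and "c = k + 1"
  define u :: perm where "u i = (if 1 \<le> i \<and> i \<le> k then k + 1 - i
    else if k + 3 \<le> i \<and> i \<le> n then n + k + 3 - i else i)" for i
  have inv: "u (u i) = i" for i by (auto simp: u_def n_def)
  have "u permutes {1..n}" by (rule involution_permutes[OF inv]) (auto simp: u_def n_def)
  moreover have "u ` {1..c} = {1..c}"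
  proof -
    have sub: "u ` {1..c} \<subseteq> {1..c}" by (auto simp: u_def c_def)
    then have "u ` u ` {1..c} \<subseteq> u ` {1..c}" by (rule image_mono)
    then show ?thesis using sub by (simp add: image_image inv)
  qed
  ultimately have u: "u \<in> parab n c" by (simp add: parab_def sym_grp_def)
  have fixed: "u c = c" "u (Suc c) = Suc c" by (simp_all add: u_def c_def)
  have xu: "x_perm k m = simple_refl c \<circ> u"
  proof
    fix i
    consider "i = 0" | "1 \<le> i" "i \<le> k" | "i = k + 1" | "i = k + 2"
      | "k + 3 \<le> i" "i \<le> k + m + 2" | "k + m + 2 < i"
      by linarith
    then show "x_perm k m i = (simple_refl c \<circ> u) i"
      using assms
      by cases (auto simp: x_perm_def one_line_def u_def n_def c_def simple_refl_apply
          nth_append nth_Cons')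
  qed
  have "x_perm k m \<circ> simple_refl c = u"
    unfolding xu commute_of_fixed[OF parab_sym_grp[OF u] fixed] simple_refl_comp_cancel ..
  moreover have "simple_refl c \<circ> x_perm k m = u" unfolding xu simple_refl_comp_cancel ..
  ultimately have "x_perm k m \<in> double_support n c"
    using u unfolding double_support_def half_support_def mem_Collect_eq by simp
  then show ?thesis unfolding n_def c_def .
qed

theorem theorem54:
  fixes k m :: nat
  assumes "k \<ge> 1" and "m \<ge> 1"
  shows "kl_poly (k + 2 + m) (x_perm k m) (w_perm k m) = [:1, 1:]"
proof -
  have "is_kl_family (k + 2 + m) (w_perm k m) (kl_coeff (k + 2 + m) (k + 1))"
    unfolding w_perm_eq_conj_block_rev[OF assms] by (rule is_kl_family_kl_coeff) (use assms in simp_all)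
  then have "kl_poly (k + 2 + m) (x_perm k m) (w_perm k m) =
      kl_coeff (k + 2 + m) (k + 1) (x_perm k m)"
    by (rule kl_poly_eqI)
  then show ?thesis using x_perm_double_support[OF assms] by (simp add: kl_coeff_def)
qed

end
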